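(* Let $(v,n)$ be one of the pairs $(2,4)$, $(3,6)$, $(2,12)$, let $\Psi_n(x)$ be the polynomial defined in the context, and let $m$ be an odd integer larger than $1$. Then for every $\varepsilon\in\{+,-\}$, either there is a prime that divides the integer $\Psi_{n}(\varepsilon\sqrt{v^{m}})$ and does not divide $v^{i}-1$ for any positive integer $i<nm$, or $v=2$, $n=4$, and $m\in\{3,5\}$.
   Context: Define polynomials with real coefficients $$\Psi_4(x)=x^2+\sqrt{2}\,x+1,\qquad \Psi_6(x)=x^2+\sqrt{3}\,x+1,\qquad \Psi_{12}(x)=x^4+\sqrt{2}\,x^3+x^2+\sqrt{2}\,x+1.$$ Here $\sqrt{v^m}$ is the positive square root, and $\Psi_n(\varepsilon\sqrt{v^m})$ means $\Psi_n(\sqrt{v^m})$ if $\varepsilon=+$ and $\Psi_n(-\sqrt{v^m})$ if $\varepsilon=-$. For the pairs $(v,n)$ in question and $m$ odd, these values are integers. The "either ... or" is inclusive: at least one of the two alternatives holds. *)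

theory Defs
  imports Complex_Main
    "HOL-Computational_Algebra.Polynomial"
    "HOL-Computational_Algebra.Primes"
begin

(* Coefficients are listed from the constant term upwards.  Only the indices
   4, 6 and 12 are meaningful; the value 0 elsewhere is a dummy. *)
definition Psi :: "nat \<Rightarrow> real poly" where
  "Psi n =
     (if n = 4 then [:1, sqrt 2, 1:]
      else if n = 6 then [:1, sqrt 3, 1:]
      else if n = 12 then [:1, sqrt 2, 1, sqrt 2, 1:]
      else 0)"

end

theory Submission
  imports Defs "HOL-Number_Theory.Pocklington" "HOL-Analysis.Harmonic_Numbers"
begin

text \<open>
  Put \<open>q = v\<^sup>m\<close>. The integers \<open>\<Psi>\<^sub>n(\<plusminus>\<surd>q)\<close> are the two Aurifeuillian factors of
  the cyclotomic value \<open>\<Phi>\<^sub>n(q)\<close>: with \<open>x = \<plusminus>v\<^bsup>(m - 1)/2\<^esup>\<close>, so that \<open>q = v x\<^sup>2\<close>, the factor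
  is an integer polynomial \<open>f(x)\<close>, and \<open>f(x) f(-x) = \<Phi>\<^sub>n(v x\<^sup>2)\<close>. A prime \<open>p\<close> dividing \<open>E = f(x)\<close> is
  to be found for which the order of \<open>v\<close> modulo \<open>p\<close> is exactly \<open>n m\<close>.

  The proof follows the classical argument of Bang and Zsigmondy. Let \<open>T\<close> be the set of primes that
  divide \<open>m\<close> but not \<open>n\<close>. For \<open>S \<subseteq> T\<close> and \<open>d = m / \<Prod>S\<close>, one of the two factors belonging to \<open>d\<close>
  divides \<open>E\<close>, and the other one divides the conjugate of \<open>E\<close>; call the first \<open>E\<^sub>S\<close>. The alternating
  product of the \<open>E\<^sub>S\<close> with exponents \<open>(-1)\<^bsup>|S|\<^esup>\<close> is the part of \<open>E\<close> not accounted for by proper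
  divisors of \<open>m\<close>, and its logarithm is estimated in two ways.

  From above: suppose that no prime divisor of \<open>E\<close> is primitive. Every \<open>p\<close> dividing \<open>E\<close> then
  divides \<open>v\<^bsup>n m / r\<^esup> - 1\<close> for some \<open>r\<close> in \<open>T\<close>. Pairing \<open>S\<close> with \<open>S \<union> {r}\<close> and lifting the exponent
  shows that the \<open>p\<close>-part cancels completely, unless \<open>p\<close> itself is the largest element of \<open>T\<close>, when a
  single factor \<open>p\<close> may survive (\<open>alternating_multiplicity_sum\<close>). So the product is at most
  \<open>Max T\<close>.

  From below: \<open>f(x)\<close> differs from \<open>(v x\<^sup>2)\<^bsup>\<kappa>\<^esup>\<close>, where \<open>2 \<kappa> = deg f\<close>, by a factor between
  \<open>exp(-\<beta>/|x|)\<close> and \<open>exp(\<beta>/|x|)\<close>. The numbers \<open>(d - 1)/2\<close> that occur are distinct, so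
  these errors add up to at most \<open>2 \<beta>\<close> in the exponent, and the product is at least
  \<open>exp(-2 \<beta>) v\<^bsup>\<kappa> \<phi>\<^esup>\<close> with \<open>\<phi> = m \<Prod>(1 - 1/r)\<close> taken over \<open>r\<close> in \<open>T\<close>.

  Both estimates together are \<open>no_primitive_prime_bound\<close>. Since \<open>\<phi> \<ge> Max T - 1\<close>, they contradict each
  other except for very small \<open>Max T\<close>, and these cases leave only \<open>m = 3\<close> and \<open>m = 5\<close> for
  \<open>(v, n) = (2, 4)\<close>. There the exceptions are genuine: \<open>8 - 4 + 1 = 5\<close> divides \<open>2\<^sup>4 - 1\<close>, and the only
  prime divisor of \<open>32 - 8 + 1 = 25\<close> is \<open>5\<close> again.
\<close>

section \<open>Orders and lifting the exponent\<close>

lemma prime_dvd_power_minus_one_iff_ord: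
  fixes p :: int and v i :: nat
  assumes "prime p" "v > 0"
  shows "p dvd int v ^ i - 1 \<longleftrightarrow> ord (nat p) v dvd i"
proof -
  have p: "int (nat p) = p" using assms(1) prime_ge_0_int by auto
  have "p dvd int v ^ i - 1 \<longleftrightarrow> [int v ^ i = 1] (mod p)"
    by (simp add: cong_iff_dvd_diff)
  also have "\<dots> \<longleftrightarrow> [int (v ^ i) = int 1] (mod int (nat p))"
    unfolding p by simp
  also have "\<dots> \<longleftrightarrow> [v ^ i = 1] (mod nat p)"
    by (rule cong_int_iff)
  finally show ?thesis unfolding ord_divides .
qed

text \<open>
  Modulo \<open>p\<close> the sum is \<open>r\<close>, which settles \<open>r \<noteq> p\<close>. For \<open>r = p\<close> one goes on to \<open>p\<^sup>2\<close>: with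
  \<open>y = 1 + p z\<close> the sum is \<open>p + p z \<cdot> p (p - 1)/2\<close>, and oddness of \<open>p\<close> makes the second term vanish.
\<close>

lemma multiplicity_geometric_sum:
  fixes p y :: int and r :: nat
  assumes "prime p" "p dvd y - 1" "prime r" "odd r"
  shows "multiplicity p (\<Sum>i<r. y ^ i) = (if int r = p then 1 else 0)"
proof -
  have cong1: "[y ^ i = 1] (mod p)" for i
    using cong_pow[of y 1 p i] assms(2) by (simp add: cong_iff_dvd_diff)
  have "[(\<Sum>i<r. y ^ i) = (\<Sum>i<r. 1)] (mod p)"
    by (intro cong_sum cong1)
  hence S: "[(\<Sum>i<r. y ^ i) = int r] (mod p)" by simp
  show ?thesis
  proof (cases "int r = p")
    case False
    have "\<not> p dvd int r"
      using False assms(1,3) primes_dvd_imp_eq prime_nat_int_transfer by blast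
    hence "\<not> p dvd (\<Sum>i<r. y ^ i)"
      using S cong_dvd_iff by blast
    thus ?thesis using False by (simp add: not_dvd_imp_multiplicity_0)
  next
    case True
    obtain z where z: "y = 1 + p * z" using assms(2) by (metis add.commute diff_add_cancel dvdE)
    have lin: "[y ^ i = 1 + int i * (p * z)] (mod p\<^sup>2)" for i
    proof (induction i)
      case (Suc i)
      have "[y ^ i * y = (1 + int i * (p * z)) * y] (mod p\<^sup>2)"
        by (intro cong_mult Suc.IH cong_refl)
      also have "(1 + int i * (p * z)) * y = 1 + int (Suc i) * (p * z) + p\<^sup>2 * (int i * z\<^sup>2)"
        by (simp add: z algebra_simps power2_eq_square)
      also have "[\<dots> = 1 + int (Suc i) * (p * z)] (mod p\<^sup>2)"
        by (simp add: cong_iff_dvd_diff)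
      finally show ?case by (simp add: mult.commute)
    qed simp
    have "[(\<Sum>i<r. y ^ i) = (\<Sum>i<r. 1 + int i * (p * z))] (mod p\<^sup>2)"
      by (intro cong_sum lin)
    also have "(\<Sum>i<r. 1 + int i * (p * z)) = p + (\<Sum>i<r. int i) * (p * z)"
      by (simp add: sum.distrib sum_distrib_right True)
    also have "(\<Sum>i<r. int i) = p * int ((r - 1) div 2)"
    proof -
      have "2 * (\<Sum>i<r. int i) = int r * (int r - 1)"
        by (induction r) (auto simp: algebra_simps)
      moreover obtain k where "r = 2 * k + 1" using assms(4) by (rule oddE)
      ultimately show ?thesis using True by auto
    qed
    also have "[p + p * int ((r - 1) div 2) * (p * z) = p] (mod p\<^sup>2)"
      by (simp add: cong_iff_dvd_diff power2_eq_square)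
    finally have S2: "[(\<Sum>i<r. y ^ i) = p] (mod p\<^sup>2)" .
    have "\<not> p\<^sup>2 dvd p"
      using assms(1) by (metis not_prime_unit power2_eq_square dvd_times_left_cancel_iff mult.right_neutral not_prime_0)
    hence "\<not> p ^ Suc 1 dvd (\<Sum>i<r. y ^ i)"
      using S2 cong_dvd_iff by (simp add: power2_eq_square cong_dvd_iff)
    moreover have "p ^ 1 dvd (\<Sum>i<r. y ^ i)"
      using S True cong_dvd_iff by fastforce
    ultimately have "multiplicity p (\<Sum>i<r. y ^ i) = 1"
      by (intro multiplicity_eqI) auto
    thus ?thesis using True by simp
  qed
qed

text \<open>
  One prime step of lifting the exponent, enough to compare the exponents of a set of primes
  with and without one of its elements.
\<close>

lemma multiplicity_power_minus_one:
  fixes p y :: int and r :: nat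
  assumes "prime p" "p dvd y - 1" "y > 1" "prime r" "odd r"
  shows "multiplicity p (y ^ r - 1) = multiplicity p (y - 1) + (if int r = p then 1 else 0)"
proof -
  have "y ^ r - 1 > 0" using assms(3,4) by (simp add: prime_gt_0_nat)
  hence "y ^ r - 1 \<noteq> 0" by simp
  hence "(\<Sum>i<r. y ^ i) \<noteq> 0" by (auto simp: power_diff_1_eq)
  hence "multiplicity p (y ^ r - 1) = multiplicity p (y - 1) + multiplicity p (\<Sum>i<r. y ^ i)"
    unfolding power_diff_1_eq using assms by (intro prime_elem_multiplicity_mult_distrib) auto
  thus ?thesis using assms by (simp add: multiplicity_geometric_sum)
qed

section \<open>Alternating sums over sets of primes\<close>

lemma prime_dvd_prod_primes_iff:
  fixes S :: "nat set"
  assumes "finite S" "\<And>r. r \<in> S \<Longrightarrow> prime r" "prime q"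
  shows "q dvd \<Prod>S \<longleftrightarrow> q \<in> S"
proof
  assume "q dvd \<Prod>S"
  then obtain s where "s \<in> S" "q dvd s" using assms by (auto simp: prime_dvd_prod_iff)
  thus "q \<in> S" using assms primes_dvd_imp_eq by blast
next
  assume "q \<in> S"
  thus "q dvd \<Prod>S" using assms(1) by (rule dvd_prodI[rotated, where f = "\<lambda>x. x"])
qed

lemma prod_primes_dvd:
  fixes T :: "nat set"
  assumes "finite T" "\<And>r. r \<in> T \<Longrightarrow> prime r" "\<And>r. r \<in> T \<Longrightarrow> r dvd m"
  shows "\<Prod>T dvd m"
  using assms
proof (induction T)
  case (insert s T)
  have "\<not> s dvd \<Prod>T" using insert prime_dvd_prod_primes_iff[of T s] by auto
  hence "coprime s (\<Prod>T)" using insert.prems(1) prime_imp_coprime by blast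
  thus ?case using insert by (simp add: divides_mult)
qed simp

text \<open>
  Pairing each \<open>S\<close> that avoids \<open>r\<close> with \<open>S \<union> {r}\<close>.
\<close>

lemma sum_Pow_split:
  fixes h :: "'a set \<Rightarrow> real"
  assumes "finite T" "r \<in> T"
  shows "(\<Sum>S\<in>Pow T. (-1) ^ card S * h S) =
         (\<Sum>S\<in>Pow (T - {r}). (-1) ^ card S * (h S - h (insert r S)))"
proof -
  have T: "Pow T = Pow (T - {r}) \<union> insert r ` Pow (T - {r})"
    using assms(2) by (metis Pow_insert insert_Diff)
  have fin: "finite (T - {r})" using assms by simp
  have inj: "inj_on (insert r) (Pow (T - {r}))" by (auto simp: inj_on_def)
  have "(\<Sum>S\<in>insert r ` Pow (T - {r}). (-1) ^ card S * h S) =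
        (\<Sum>S\<in>Pow (T - {r}). - ((-1) ^ card S * h (insert r S)))"
    unfolding sum.reindex[OF inj] o_def
  proof (rule sum.cong)
    fix S assume "S \<in> Pow (T - {r})"
    hence "card (insert r S) = Suc (card S)"
      using fin by (subst card_insert_disjoint) (auto dest: finite_subset)
    thus "(-1) ^ card (insert r S) * h (insert r S) = - ((-1) ^ card S * h (insert r S))" by simp
  qed simp
  moreover have "(\<Sum>S\<in>Pow T. (-1) ^ card S * h S) =
      (\<Sum>S\<in>Pow (T - {r}). (-1) ^ card S * h S) + (\<Sum>S\<in>insert r ` Pow (T - {r}). (-1) ^ card S * h S)"
    unfolding T using fin by (intro sum.union_disjoint) auto
  ultimately show ?thesis
    by (simp add: right_diff_distrib sum_subtractf sum_negf)
qed

text \<open>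
  Write \<open>M = o t\<close> where \<open>o\<close> is the order of \<open>v\<close> modulo \<open>p\<close>. For \<open>k\<close> dividing \<open>M\<close>, the prime \<open>p\<close>
  divides \<open>v\<^bsup>M/k\<^esup> - 1\<close> exactly if \<open>k\<close> divides \<open>t\<close>. Hence, if \<open>s \<in> T\<close> divides \<open>t\<close>, the terms of \<open>S\<close>
  and \<open>S \<union> {s}\<close> are both zero or both positive, and they differ by the exponent gained in
  one lifting step, which is zero for \<open>s \<noteq> p\<close>. So a nonzero sum forces \<open>p\<close> to be the only element of
  \<open>T\<close> dividing \<open>t\<close>; then all the other elements divide \<open>o\<close>, hence \<open>p - 1\<close>, and \<open>p\<close> is the largest.
\<close>

lemma alternating_multiplicity_sum:
  fixes p :: int and v M :: nat and T :: "nat set"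
  assumes p: "prime p" and v: "v > 1" and M: "M > 0" and T: "finite T"
    and primes: "\<And>r. r \<in> T \<Longrightarrow> prime r \<and> odd r"
    and TM: "\<Prod>T dvd M"
    and pM: "p dvd int v ^ M - 1"
    and r: "r \<in> T" "p dvd int v ^ (M div r) - 1"
  shows "(\<Sum>S\<in>Pow T. (-1) ^ card S * real (multiplicity p (int v ^ (M div \<Prod>S) - 1))) \<le>
         (if p = int (Max T) then 1 else 0)"
proof -
  define o' where "o' = ord (nat p) v"
  have dvd_iff: "p dvd int v ^ i - 1 \<longleftrightarrow> o' dvd i" for i
    using prime_dvd_power_minus_one_iff_ord[OF p] v by (simp add: o'_def)
  have "o' dvd M" using pM dvd_iff by simp
  then obtain t where t: "M = o' * t" by (rule dvdE)
  have o'0: "o' > 0" using M t by auto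
  define h where "h S = multiplicity p (int v ^ (M div \<Prod>S) - 1)" for S
  have prodM: "\<Prod>S dvd M" if "S \<subseteq> T" for S
    using prod_dvd_prod_subset[OF T that, of "\<lambda>x. x"] TM dvd_trans by blast
  have div_iff: "o' dvd M div k \<longleftrightarrow> k dvd t" if "k dvd M" for k
  proof -
    obtain j where j: "M = k * j" using \<open>k dvd M\<close> by (rule dvdE)
    hence k0: "k > 0" and "M div k = j" using M by auto
    have "o' dvd j \<longleftrightarrow> k * o' dvd o' * t" using k0 j t by auto
    thus ?thesis using \<open>M div k = j\<close> o'0 by (simp add: mult.commute)
  qed
  have step: "real (h S) - real (h (insert s S)) =
      (if \<Prod>S dvd t \<and> int s = p then 1 else 0)"
    if "S \<subseteq> T - {s}" "s \<in> T" "s dvd t" for S s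
  proof -
    have finS: "finite S" and "s \<notin> S" using that T finite_subset by auto
    hence ins: "\<Prod>(insert s S) = s * \<Prod>S" by simp
    have S: "\<Prod>S dvd M" "s * \<Prod>S dvd M"
      using prodM[of S] prodM[of "insert s S"] that ins by auto
    have ps: "prime s" "odd s" using primes that by auto
    have "\<not> s dvd \<Prod>S"
      using prime_dvd_prod_primes_iff[of S s] finS primes ps \<open>s \<notin> S\<close> that by auto
    hence cop: "coprime s (\<Prod>S)" using ps prime_imp_coprime by blast
    show ?thesis
    proof (cases "\<Prod>S dvd t")
      case False
      hence "\<not> s * \<Prod>S dvd t" using dvd_mult_right by blast
      hence "h S = 0" "h (insert s S) = 0"
        using False div_iff S by (simp_all add: h_def ins dvd_iff not_dvd_imp_multiplicity_0)
      thus ?thesis using False by simp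
    next
      case True
      hence d: "s * \<Prod>S dvd t" using that(3) cop by (simp add: divides_mult)
      define e where "e = M div (s * \<Prod>S)"
      have e: "M div \<Prod>S = e * s"
        using S by (metis e_def M dvd_div_mult_self dvd_mult_imp_div div_mult2_eq mult.commute)
      have e0: "e > 0" unfolding e_def using S M by (metis dvd_div_eq_0_iff neq0_conv)
      have "p dvd int v ^ e - 1" using d div_iff S by (simp add: dvd_iff e_def)
      moreover have "int v ^ e > 1" using v e0 by simp
      ultimately have "multiplicity p ((int v ^ e) ^ s - 1) =
          multiplicity p (int v ^ e - 1) + (if int s = p then 1 else 0)"
        using multiplicity_power_minus_one p ps by blast
      hence "h S = h (insert s S) + (if int s = p then 1 else 0)"
        by (simp add: h_def e ins e_def[symmetric] power_mult)
      thus ?thesis using True by simp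
    qed
  qed
  have rt: "r dvd t" using r div_iff[of r] prodM[of "{r}"] dvd_iff by simp
  show ?thesis
  proof (cases "\<exists>s\<in>T. s dvd t \<and> int s \<noteq> p")
    case True
    then obtain s where s: "s \<in> T" "s dvd t" "int s \<noteq> p" by blast
    have "(\<Sum>S\<in>Pow T. (-1) ^ card S * real (h S)) = 0"
      using s step[of _ s] by (simp add: sum_Pow_split[OF T s(1)])
    thus ?thesis by (simp add: h_def)
  next
    case False
    hence pr: "int r = p" using r rt by auto
    have only: "s = r" if "s \<in> T" "s dvd t" for s
    proof -
      have "int s = int r" using False that pr by blast
      thus ?thesis by simp
    qed
    have "(\<Sum>S\<in>Pow T. (-1) ^ card S * real (h S)) =
        (\<Sum>S\<in>Pow (T - {r}). (-1) ^ card S * (if \<Prod>S dvd t \<and> int r = p then 1 else 0))"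
      unfolding sum_Pow_split[OF T r(1)] using step[OF _ r(1) rt] by (intro sum.cong) auto
    also have "\<dots> = (\<Sum>S\<in>Pow (T - {r}). if S = {} then 1 else 0)"
    proof (rule sum.cong)
      fix S assume S: "S \<in> Pow (T - {r})"
      have "S = {}" if "\<Prod>S dvd t"
      proof (rule ccontr)
        assume "S \<noteq> {}"
        then obtain s where s: "s \<in> S" by blast
        have "finite S" using S T finite_subset by auto
        hence "s dvd \<Prod>S" using s dvd_prodI by blast
        hence "s = r" using only[of s] S s that dvd_trans by blast
        thus False using S s by auto
      qed
      thus "(-1) ^ card S * (if \<Prod>S dvd t \<and> int r = p then 1 else 0) = (if S = {} then 1 else (0::real))"
        using pr by auto
    qed simp
    also have "\<dots> = 1" using T by simp
    finally have one: "(\<Sum>S\<in>Pow T. (-1) ^ card S * real (h S)) = 1" .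
    have "s \<le> r" if "s \<in> T" for s
    proof (cases "s = r")
      case False
      have "\<not> s dvd t" using only that False by blast
      moreover have "s dvd o' * t"
        using prodM[of "{s}"] that t by simp
      ultimately have "s dvd o'" using primes that prime_dvd_mult_iff by blast
      moreover have "coprime r v"
        using o'0 pr unfolding o'_def by (metis nat_int ord_eq_0 less_irrefl)
      hence "o' dvd r - 1"
        using order_divides_totient[of r v] pr primes r(1) by (auto simp: o'_def totient_prime)
      ultimately have "s dvd r - 1" using dvd_trans by blast
      moreover have "r > 1" using primes r(1) prime_gt_1_nat by blast
      ultimately have "s \<le> r - 1" by (intro dvd_imp_le) auto
      thus ?thesis by simp
    qed simp
    hence "Max T = r" using T r(1) by (intro Max_eqI) auto
    thus ?thesis using one pr by (simp add: h_def)
  qed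
qed

text \<open>
  Summing over the prime factors of a fixed multiple \<open>E\<close> of \<open>e\<close> gives all the divisors \<open>e\<close> of \<open>E\<close> a
  common index set, so that sums over \<open>e\<close> and over primes can be interchanged.
\<close>

lemma ln_eq_sum_multiplicity:
  fixes E e :: int
  assumes "E > 0" "e > 0" "e dvd E"
  shows "ln (real_of_int e) = (\<Sum>p\<in>prime_factors E. real (multiplicity p e) * ln (real_of_int p))"
proof -
  have "real_of_int e = real_of_int (\<Prod>p\<in>prime_factors e. p ^ multiplicity p e)"
    using assms by (subst prod_prime_factors) auto
  also have "\<dots> = (\<Prod>p\<in>prime_factors e. real_of_int p ^ multiplicity p e)" by simp
  also have "ln \<dots> = (\<Sum>p\<in>prime_factors e. ln (real_of_int p ^ multiplicity p e))"
    by (intro ln_prod) (auto simp: prime_gt_0_int in_prime_factors_iff)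
  also have "\<dots> = (\<Sum>p\<in>prime_factors e. real (multiplicity p e) * ln (real_of_int p))"
    by (intro sum.cong) (auto simp: ln_realpow prime_gt_0_int in_prime_factors_iff)
  also have "\<dots> = (\<Sum>p\<in>prime_factors E. real (multiplicity p e) * ln (real_of_int p))"
    using assms
    by (intro sum.mono_neutral_left dvd_prime_factors)
       (auto simp: in_prime_factors_iff not_dvd_imp_multiplicity_0)
  finally show ?thesis .
qed

lemma sum_half_powers_le_2:
  assumes "finite (A :: nat set)"
  shows "(\<Sum>j\<in>A. (1/2 :: real) ^ j) \<le> 2"
  using sum_le_suminf[of "\<lambda>j. (1/2::real) ^ j" A] assms
  by (simp add: suminf_geometric summable_geometric)

lemma sum_sign_div_prod:
  fixes T :: "nat set"
  assumes "finite T"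
  shows "(\<Sum>S\<in>Pow T. (-1) ^ card S * (c / real (\<Prod>S))) = c * (\<Prod>r\<in>T. 1 - 1 / real r)"
proof -
  have "(\<Prod>r\<in>T. 1 - 1 / real r) = (\<Sum>S\<in>Pow T. (-1) ^ card S * (1 / real (\<Prod>S)))"
    using prod_diff_conv_sum[OF assms, of "\<lambda>_. 1::real" "\<lambda>r. 1 / real r"]
    by (simp add: prod_dividef)
  thus ?thesis by (simp add: sum_distrib_left mult_ac)
qed

text \<open>
  This injectivity is what keeps the accumulated error bounded independently of the number of
  primes dividing \<open>m\<close>: each power of \<open>1/2\<close> occurs at most once among the error terms.
\<close>

lemma inj_on_div_prod_primes:
  fixes T :: "nat set"
  assumes "finite T" "\<And>r. r \<in> T \<Longrightarrow> prime r" "\<Prod>T dvd m" "odd m"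
  shows "inj_on (\<lambda>S. m div \<Prod>S div 2) (Pow T)"
proof (rule inj_onI)
  fix A B assume AB: "A \<in> Pow T" "B \<in> Pow T" "m div \<Prod>A div 2 = m div \<Prod>B div 2"
  have fin: "finite A" "finite B" using AB assms(1) finite_subset by auto
  have m: "m > 0" using assms(4) by (rule odd_pos)
  have dvd: "\<Prod>A dvd m" "\<Prod>B dvd m"
    using AB prod_dvd_prod_subset[OF assms(1), of _ "\<lambda>x. x"] assms(3) dvd_trans by auto
  hence "odd (m div \<Prod>A)" "odd (m div \<Prod>B)"
    using assms(4) by (metis dvd_div_mult_self dvd_mult2)+
  hence eq: "m div \<Prod>A = m div \<Prod>B" using AB(3) by (metis odd_two_times_div_two_succ)
  have "\<Prod>A * (m div \<Prod>A) = \<Prod>B * (m div \<Prod>A)" using dvd by (metis eq dvd_mult_div_cancel)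
  moreover have "m div \<Prod>A > 0" using \<open>odd (m div \<Prod>A)\<close> by (rule odd_pos)
  ultimately have "\<Prod>A = \<Prod>B" by simp
  thus "A = B"
    using prime_dvd_prod_primes_iff[of A] prime_dvd_prod_primes_iff[of B] fin assms(2) AB
    by (metis PowD subsetD subsetI subset_antisym)
qed

section \<open>Aurifeuillian factors without primitive primes\<close>

text \<open>
  The polynomial function \<open>f\<close> stands for one Aurifeuillian factor, in the integer variable \<open>x\<close> with
  \<open>\<Psi>\<^sub>n(\<surd>v x) = f(x)\<close>, and \<open>v x\<^sup>2\<close> plays the role of the argument of \<open>\<Phi>\<^sub>n\<close>. The function \<open>R\<close> is the
  cofactor of \<open>\<Phi>\<^sub>n(v x\<^sup>2)\<close> in \<open>(v x\<^sup>2)\<^sup>n - 1\<close>. The assumptions \<open>R\<close> and \<open>order_n\<close> say that primes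
  dividing this cofactor see \<open>v x\<^sup>2\<close> with an order properly dividing \<open>n\<close>, while those dividing \<open>f(x)\<close> see
  it with order exactly \<open>n\<close>. In \<open>f_dvd\<close>, \<open>x (v x\<^sup>2)\<^bsup>(k - 1)/2\<^esup>\<close> is the variable belonging to the
  \<open>k\<close>-th power of \<open>\<surd>v x\<close>; the sign \<open>\<sigma>\<close>, depending on \<open>k\<close> alone, is the value at \<open>k\<close> of the quadratic
  character of \<open>\<rat>(\<surd>v)\<close>.
\<close>

locale aurifeuillian =
  fixes v n :: nat and f R :: "int \<Rightarrow> int" and \<kappa> \<beta> :: real
  assumes v: "v > 1" and even_n: "even n" "n > 0" and \<beta>: "\<beta> \<ge> 0"
    and factor: "(int v * x\<^sup>2) ^ n - 1 = f x * f (-x) * R x"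
    and R: "prime p \<Longrightarrow> p dvd R x \<Longrightarrow>
              \<exists>l. prime l \<and> l dvd n \<and> p dvd (int v * x\<^sup>2) ^ (n div l) - 1"
    and order_n: "prime p \<Longrightarrow> p dvd f x \<Longrightarrow> prime l \<Longrightarrow> l dvd n \<Longrightarrow>
              \<not> p dvd (int v * x\<^sup>2) ^ (n div l) - 1"
    and conj_coprime: "prime p \<Longrightarrow> p dvd f x \<Longrightarrow> \<not> p dvd f (-x)"
    and f_dvd: "coprime k n \<Longrightarrow> \<exists>\<sigma>\<in>{1, -1}. \<forall>x. f x dvd f (\<sigma> * x * (int v * x\<^sup>2) ^ (k div 2))"
    and f_pos: "f x > 0"
    and size: "x \<noteq> 0 \<Longrightarrow> \<bar>ln (of_int (f x)) - \<kappa> * ln (of_int (int v * x\<^sup>2))\<bar> \<le> \<beta> / \<bar>of_int x\<bar>"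
begin

lemma base_power:
  fixes \<delta> :: int
  assumes "\<delta> \<in> {1, -1}" "odd d"
  shows "int v * (\<delta> * int v ^ (d div 2))\<^sup>2 = int v ^ d"
proof -
  have "\<delta>\<^sup>2 = 1" using assms(1) by auto
  hence "int v * (\<delta> * int v ^ (d div 2))\<^sup>2 = int v ^ (Suc (2 * (d div 2)))"
    by (simp add: power_mult_distrib power_mult[symmetric] mult.commute)
  also have "Suc (2 * (d div 2)) = d" using assms(2) by presburger
  finally show ?thesis .
qed

text \<open>
  The same sign \<open>\<delta>\<close> must serve \<open>f\<close> at \<open>x\<close> and at \<open>-x\<close>: the second divisibility is what later
  shows that the complementary factor is prime to the divisors of the first number.
\<close>

lemma factor_dvd_shift:
  fixes \<epsilon> :: int
  assumes "\<epsilon> \<in> {1, -1}" "odd d" "coprime k n"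
  shows "\<exists>\<delta>\<in>{1, -1}. f (\<delta> * int v ^ (d div 2)) dvd f (\<epsilon> * int v ^ (d * k div 2)) \<and>
           f (- (\<delta> * int v ^ (d div 2))) dvd f (- (\<epsilon> * int v ^ (d * k div 2)))"
proof -
  obtain \<sigma> where \<sigma>: "\<sigma> \<in> {1, -1}"
    "\<And>x. f x dvd f (\<sigma> * x * (int v * x\<^sup>2) ^ (k div 2))" using f_dvd[OF assms(3)] by blast
  have "odd k" using assms(3) even_n by (metis coprime_common_divisor odd_one)
  then obtain j where k: "k = 2 * j + 1" by (rule oddE)
  obtain i where d: "d = 2 * i + 1" using assms(2) by (rule oddE)
  have div: "d * k div 2 = d div 2 + d * (k div 2)" by (simp add: d k algebra_simps)
  have shift: "f (\<delta> * int v ^ (d div 2)) dvd f (\<sigma> * \<delta> * int v ^ (d * k div 2))"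
    if "\<delta> \<in> {1, -1}" for \<delta> :: int
  proof -
    have "\<sigma> * (\<delta> * int v ^ (d div 2)) * (int v * (\<delta> * int v ^ (d div 2))\<^sup>2) ^ (k div 2)
        = \<sigma> * \<delta> * int v ^ (d * k div 2)"
      unfolding base_power[OF that assms(2)] by (simp add: div power_add power_mult)
    thus ?thesis using \<sigma>(2)[of "\<delta> * int v ^ (d div 2)"] by (simp only:)
  qed
  have mem: "\<sigma> * \<epsilon> \<in> {1, -1}" "- (\<sigma> * \<epsilon>) \<in> {1, -1}" using \<sigma>(1) assms(1) by auto
  have sgn: "\<sigma> * (\<sigma> * \<epsilon>) = \<epsilon>" "\<sigma> * - (\<sigma> * \<epsilon>) = - \<epsilon>" using \<sigma>(1) by auto
  show ?thesis
    using shift[OF mem(1)] shift[OF mem(2)] mem unfolding sgn by (intro bexI[of _ "\<sigma> * \<epsilon>"]) auto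
qed

lemma factor_dvd_power_minus_one:
  fixes \<epsilon> :: int
  assumes "\<epsilon> \<in> {1, -1}" "odd m"
  shows "f (\<epsilon> * int v ^ (m div 2)) dvd int v ^ (n * m) - 1"
  using factor[of "\<epsilon> * int v ^ (m div 2)"] base_power[OF assms]
  by (simp add: mult.commute[of n] power_mult)

text \<open>
  In \<open>v\<^bsup>n d\<^esup> - 1 = f(y) f(-y) R(y)\<close> only the first factor can be divisible by a \<open>p\<close> dividing
  \<open>f(x)\<close>: the second divides \<open>f(-x)\<close>, and if \<open>p\<close> divided the third, then \<open>v\<^sup>d\<close>, and with it
  its power \<open>v\<^sup>m\<close>, would have order less than \<open>n\<close>. Exponents in Aurifeuillian factors are thereby reduced
  to exponents in numbers \<open>v\<^sup>i - 1\<close>.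
\<close>

lemma multiplicity_factor:
  fixes p \<epsilon> \<delta> :: int
  assumes p: "prime p" and signs: "\<epsilon> \<in> {1, -1}" "\<delta> \<in> {1, -1}" and m: "odd m" "d dvd m"
    and pf: "p dvd f (\<epsilon> * int v ^ (m div 2))"
    and dvd: "f (- (\<delta> * int v ^ (d div 2))) dvd f (- (\<epsilon> * int v ^ (m div 2)))"
  shows "multiplicity p (f (\<delta> * int v ^ (d div 2))) = multiplicity p (int v ^ (n * d) - 1)"
proof -
  define x where "x = \<delta> * int v ^ (d div 2)"
  have d: "odd d" using m by (metis dvd_trans)
  have base: "int v * x\<^sup>2 = int v ^ d" unfolding x_def by (rule base_power[OF signs(2) d])
  have conj: "\<not> p dvd f (-x)"
    using conj_coprime[OF p pf] dvd by (auto simp: x_def dest: dvd_trans)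
  have "\<not> p dvd R x"
  proof
    assume "p dvd R x"
    then obtain l where l: "prime l" "l dvd n" "p dvd int v ^ (d * (n div l)) - 1"
      using R[OF p, of x] base by (auto simp: power_mult)
    obtain k where k: "m = d * k" using m(2) by (rule dvdE)
    have "int v ^ (d * (n div l)) - 1 dvd int v ^ (m * (n div l)) - 1"
      unfolding k using power_diff_1_eq[of "int v ^ (d * (n div l))" k]
      by (simp add: power_mult[symmetric] mult_ac)
    hence "p dvd (int v ^ m) ^ (n div l) - 1" using l(3) by (metis dvd_trans power_mult)
    thus False using order_n[OF p pf l(1,2)] base_power[OF signs(1) m(1)] by simp
  qed
  hence np: "\<not> p dvd f (-x) * R x" using conj p by (simp add: prime_dvd_mult_iff)
  have eq: "int v ^ (n * d) - 1 = f x * (f (-x) * R x)"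
    using factor[of x] base by (simp add: power_mult[symmetric] mult_ac)
  have "f x \<noteq> 0" using f_pos[of x] by simp
  moreover have "f (-x) * R x \<noteq> 0" using np by auto
  ultimately have "multiplicity p (int v ^ (n * d) - 1) = multiplicity p (f x) + multiplicity p (f (-x) * R x)"
    unfolding eq using p by (intro prime_elem_multiplicity_mult_distrib) auto
  thus ?thesis using np by (simp add: not_dvd_imp_multiplicity_0 x_def)
qed

definition unramified_primes :: "nat \<Rightarrow> nat set" where
  "unramified_primes m = {r. prime r \<and> r dvd m \<and> \<not> r dvd n}"

text \<open>
  The order of \<open>v\<close> is a proper divisor of \<open>n m\<close>, so it divides \<open>n m / l\<close> for some prime \<open>l\<close>; and \<open>l\<close>
  cannot divide \<open>n\<close>, because \<open>v\<^sup>m\<close> has order exactly \<open>n\<close>.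
\<close>

lemma non_primitive_prime:
  fixes p \<epsilon> :: int
  assumes p: "prime p" and "\<epsilon> \<in> {1, -1}" "odd m" and pf: "p dvd f (\<epsilon> * int v ^ (m div 2))"
    and i: "0 < i" "i < n * m" "p dvd int v ^ i - 1"
  shows "\<exists>r\<in>unramified_primes m. p dvd int v ^ (n * m div r) - 1"
proof -
  define o' where "o' = ord (nat p) v"
  have dvd_iff: "p dvd int v ^ i - 1 \<longleftrightarrow> o' dvd i" for i
    using prime_dvd_power_minus_one_iff_ord[OF p] v by (simp add: o'_def)
  have "o' dvd n * m" using dvd_trans[OF pf factor_dvd_power_minus_one] assms dvd_iff by blast
  then obtain t where t: "n * m = o' * t" by (rule dvdE)
  have "o' \<le> i" using i dvd_iff dvd_imp_le by blast
  hence "t \<noteq> 1" using t i(2) by auto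
  then obtain l where l: "prime l" "l dvd t" using prime_factor_nat by blast
  obtain s where s: "t = l * s" using l(2) by (rule dvdE)
  have "n * m div l = o' * s" using t s l(1) prime_gt_0_nat[of l] by (simp add: ac_simps)
  hence pl: "p dvd int v ^ (n * m div l) - 1" by (simp add: dvd_iff)
  have "\<not> l dvd n"
  proof
    assume ln: "l dvd n"
    hence "n * m div l = m * (n div l)" by (metis div_mult_swap mult.commute)
    hence "p dvd (int v ^ m) ^ (n div l) - 1" using pl by (simp add: power_mult)
    thus False using order_n[OF p pf l(1) ln] base_power[OF assms(2,3)] by simp
  qed
  moreover from this have "l dvd m" using l t by (metis dvd_mult prime_dvd_mult_iff mult.commute)
  ultimately have "l \<in> unramified_primes m" using l(1) by (simp add: unramified_primes_def)
  thus ?thesis using pl by blast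
qed

text \<open>
  Both bounds are on the logarithm \<open>L\<close> of the alternating product. The upper one expands \<open>L\<close> prime
  by prime; the lower one compares each \<open>ln E\<^sub>S\<close> with \<open>\<kappa> d ln v\<close>, where \<open>d = m / \<Prod>S\<close>, and
  \<open>|x| \<ge> 2\<^bsup>(d - 1)/2\<^esup>\<close> turns the error \<open>\<beta>/|x|\<close> into a term of a geometric series of sum \<open>2 \<beta>\<close>.
\<close>

lemma no_primitive_prime_bound:
  fixes \<epsilon> :: int
  assumes \<epsilon>: "\<epsilon> \<in> {1, -1}" and m: "odd m"
    and big: "f (\<epsilon> * int v ^ (m div 2)) > 1"
    and none: "\<And>p. prime p \<Longrightarrow> p dvd f (\<epsilon> * int v ^ (m div 2)) \<Longrightarrow>
                 \<exists>i. 0 < i \<and> i < n * m \<and> p dvd int v ^ i - 1"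
  defines "T \<equiv> unramified_primes m"
  shows "T \<noteq> {}"
    and "\<kappa> * ln (real v) * (real m * (\<Prod>r\<in>T. 1 - 1 / real r)) \<le> ln (real (Max T)) + 2 * \<beta>"
proof -
  define E where "E = f (\<epsilon> * int v ^ (m div 2))"
  have m0: "m > 0" using m by (rule odd_pos)
  have T: "finite T" using m0 unfolding T_def unramified_primes_def
    by (intro finite_subset[OF _ finite_divisors_nat[of m]]) auto
  have Tp: "prime r" "r dvd m" "\<not> r dvd n" "odd r" if "r \<in> T" for r
  proof -
    show r: "prime r" "r dvd m" "\<not> r dvd n" using that by (auto simp: T_def unramified_primes_def)
    show "odd r" using r(2) m dvd_trans by blast
  qed
  have coprime_n: "coprime (\<Prod>S) n" if "S \<subseteq> T" for S
    using that Tp by (intro prod_coprime_left) (meson prime_imp_coprime subsetD)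
  have Tm: "\<Prod>T dvd m"
    using T Tp(1,2) by (rule prod_primes_dvd)
  have Sm: "\<Prod>S dvd m" if "S \<subseteq> T" for S
    using prod_dvd_prod_subset[OF T that, of "\<lambda>x. x"] Tm dvd_trans by blast
  define d where "d S = m div \<Prod>S" for S
  have d: "d S * \<Prod>S = m" "odd (d S)" "d S dvd m" if "S \<subseteq> T" for S
  proof -
    show "d S * \<Prod>S = m" unfolding d_def using Sm[OF that] by simp
    thus "odd (d S)" "d S dvd m" using m by (metis even_mult_iff, metis dvd_triv_left)
  qed
  have "\<forall>S\<in>Pow T. \<exists>\<delta>. \<delta> \<in> {1, -1} \<and> f (\<delta> * int v ^ (d S div 2)) dvd E \<and>
      f (- (\<delta> * int v ^ (d S div 2))) dvd f (- (\<epsilon> * int v ^ (m div 2)))"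
    using factor_dvd_shift[OF \<epsilon> d(2) coprime_n] d(1) unfolding E_def by (metis PowD)
  then obtain \<delta> where \<delta>: "\<And>S. S \<subseteq> T \<Longrightarrow> \<delta> S \<in> {1, -1}"
      "\<And>S. S \<subseteq> T \<Longrightarrow> f (\<delta> S * int v ^ (d S div 2)) dvd E"
      "\<And>S. S \<subseteq> T \<Longrightarrow> f (- (\<delta> S * int v ^ (d S div 2))) dvd f (- (\<epsilon> * int v ^ (m div 2)))"
    by (metis Pow_iff)
  define e where "e S = f (\<delta> S * int v ^ (d S div 2))" for S
  have np: "\<exists>r\<in>T. p dvd int v ^ (n * m div r) - 1" if "p \<in> prime_factors E" for p
    using none[of p] non_primitive_prime[OF _ \<epsilon> m] that unfolding T_def E_def
    by (metis in_prime_factors_iff)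
  obtain q where "prime q" "q dvd E"
    using big prime_divisor_exists[of E] unfolding E_def by auto
  hence "q \<in> prime_factors E" using big by (auto simp: in_prime_factors_iff E_def)
  thus T_ne: "T \<noteq> {}" using np by blast
  define L where "L = (\<Sum>S\<in>Pow T. (-1) ^ card S * ln (real_of_int (e S)))"
  have "L \<le> ln (real (Max T))"
  proof -
    have ln_e: "ln (real_of_int (e S)) = (\<Sum>p\<in>prime_factors E.
        real (multiplicity p (int v ^ (n * m div \<Prod>S) - 1)) * ln (real_of_int p))" if "S \<subseteq> T" for S
    proof -
      have "ln (real_of_int (e S)) = (\<Sum>p\<in>prime_factors E. real (multiplicity p (e S)) * ln (real_of_int p))"
        using big f_pos \<delta>(2)[OF that] by (intro ln_eq_sum_multiplicity) (auto simp: e_def E_def)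
      also have "\<dots> = (\<Sum>p\<in>prime_factors E.
        real (multiplicity p (int v ^ (n * m div \<Prod>S) - 1)) * ln (real_of_int p))"
      proof (rule sum.cong)
        fix p assume "p \<in> prime_factors E"
        hence "multiplicity p (e S) = multiplicity p (int v ^ (n * d S) - 1)"
          unfolding e_def using \<delta>[OF that] d[OF that] \<epsilon> m
          by (intro multiplicity_factor[where \<epsilon> = \<epsilon> and m = m]) (auto simp: in_prime_factors_iff E_def)
        moreover have "n * d S = n * m div \<Prod>S" unfolding d_def using Sm[OF that] by (simp add: div_mult_swap)
        ultimately show "real (multiplicity p (e S)) * ln (real_of_int p) =
          real (multiplicity p (int v ^ (n * m div \<Prod>S) - 1)) * ln (real_of_int p)" by simp
      qed simp
      finally show ?thesis .
    qed
    have "L = (\<Sum>S\<in>Pow T. \<Sum>p\<in>prime_factors E. (-1) ^ card S *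
        (real (multiplicity p (int v ^ (n * m div \<Prod>S) - 1)) * ln (real_of_int p)))"
      unfolding L_def by (intro sum.cong) (auto simp: ln_e sum_distrib_left)
    also have "\<dots> = (\<Sum>p\<in>prime_factors E. ln (real_of_int p) * (\<Sum>S\<in>Pow T. (-1) ^ card S *
        real (multiplicity p (int v ^ (n * m div \<Prod>S) - 1))))"
      by (subst sum.swap) (simp add: sum_distrib_left mult_ac)
    also have "\<dots> \<le> (\<Sum>p\<in>prime_factors E. ln (real_of_int p) * (if p = int (Max T) then 1 else 0))"
    proof (intro sum_mono mult_left_mono)
      fix p assume pE: "p \<in> prime_factors E"
      hence p: "prime p" "p dvd E" by (auto simp: in_prime_factors_iff)
      thus "ln (real_of_int p) \<ge> 0" using prime_ge_1_int[of p] by simp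
      obtain r where "r \<in> T" "p dvd int v ^ (n * m div r) - 1" using np[OF pE] by blast
      moreover have "p dvd int v ^ (n * m) - 1"
        using p factor_dvd_power_minus_one[OF \<epsilon> m] dvd_trans unfolding E_def by blast
      ultimately show "(\<Sum>S\<in>Pow T. (-1) ^ card S * real (multiplicity p (int v ^ (n * m div \<Prod>S) - 1)))
          \<le> (if p = int (Max T) then 1 else 0)"
        using p v even_n m0 T Tp Tm
        by (intro alternating_multiplicity_sum) auto
    qed
    also have "\<dots> = (\<Sum>p\<in>prime_factors E. if p = int (Max T) then ln (real (Max T)) else 0)"
      by (intro sum.cong) auto
    also have "\<dots> \<le> ln (real (Max T))"
      using Max_in[OF T T_ne] Tp(1) prime_ge_1_nat[of "Max T"] by (auto simp: sum.delta)
    finally show ?thesis .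
  qed
  moreover have "L \<ge> \<kappa> * ln (real v) * (real m * (\<Prod>r\<in>T. 1 - 1 / real r)) - 2 * \<beta>"
  proof -
    have e_size: "\<bar>ln (real_of_int (e S)) - \<kappa> * ln (real v) * (real m / real (\<Prod>S))\<bar> \<le> \<beta> * (1/2) ^ (d S div 2)"
      if "S \<subseteq> T" for S
    proof -
      define x where "x = \<delta> S * int v ^ (d S div 2)"
      have x0: "x \<noteq> 0" using \<delta>(1)[OF that] v by (auto simp: x_def)
      have "real (\<Prod>S) > 0" using that Tp(1) by (force intro!: prod_pos simp: prime_gt_0_nat)
      moreover have "real (d S) * real (\<Prod>S) = real m" using d(1)[OF that] by (metis of_nat_mult)
      ultimately have dS: "real (d S) = real m / real (\<Prod>S)" by (simp add: field_simps)
      have "\<bar>real_of_int x\<bar> = real v ^ (d S div 2)" using \<delta>(1)[OF that] by (auto simp: x_def abs_mult)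
      moreover have "(2::real) ^ (d S div 2) \<le> real v ^ (d S div 2)" using v by (intro power_mono) auto
      ultimately have "\<beta> / \<bar>real_of_int x\<bar> \<le> \<beta> / 2 ^ (d S div 2)"
        using \<beta> v by (intro divide_left_mono) auto
      moreover have "int v * x\<^sup>2 = int v ^ d S" unfolding x_def by (rule base_power[OF \<delta>(1) d(2)]) fact+
      hence "\<kappa> * ln (of_int (int v * x\<^sup>2)) = \<kappa> * ln (real v) * real (d S)"
        using v by (simp only: of_int_power of_int_of_nat_eq) (simp add: ln_realpow)
      hence "\<bar>ln (real_of_int (e S)) - \<kappa> * ln (real v) * (real m / real (\<Prod>S))\<bar> \<le> \<beta> / \<bar>of_int x\<bar>"
        using size[OF x0] unfolding dS e_def x_def[symmetric] by metis
      moreover have "\<beta> * (1/2) ^ (d S div 2) = \<beta> / 2 ^ (d S div 2)" by (simp add: power_one_over)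
      ultimately show ?thesis by linarith
    qed
    have "\<kappa> * ln (real v) * (real m * (\<Prod>r\<in>T. 1 - 1 / real r)) - L =
        (\<Sum>S\<in>Pow T. (-1) ^ card S * (\<kappa> * ln (real v) * (real m / real (\<Prod>S)) - ln (real_of_int (e S))))"
      unfolding L_def using sum_sign_div_prod[OF T, of "\<kappa> * ln (real v) * real m"]
      by (simp add: right_diff_distrib sum_subtractf mult.assoc)
    also have "\<dots> \<le> (\<Sum>S\<in>Pow T. \<beta> * (1/2) ^ (d S div 2))"
    proof (rule sum_mono)
      fix S assume "S \<in> Pow T"
      hence "\<bar>(-1) ^ card S * (\<kappa> * ln (real v) * (real m / real (\<Prod>S)) - ln (real_of_int (e S)))\<bar>
          \<le> \<beta> * (1/2) ^ (d S div 2)"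
        using e_size[of S] by (simp add: abs_mult power_abs abs_minus_commute)
      thus "(-1) ^ card S * (\<kappa> * ln (real v) * (real m / real (\<Prod>S)) - ln (real_of_int (e S)))
          \<le> \<beta> * (1/2) ^ (d S div 2)" by linarith
    qed
    also have "\<dots> = \<beta> * (\<Sum>j\<in>(\<lambda>S. d S div 2) ` Pow T. (1/2) ^ j)"
      using inj_on_div_prod_primes[OF T Tp(1) Tm m]
      by (simp add: sum.reindex d_def sum_distrib_left)
    also have "\<dots> \<le> \<beta> * 2"
      using T \<beta> by (intro mult_left_mono sum_half_powers_le_2) auto
    finally show ?thesis by simp
  qed
  ultimately show "\<kappa> * ln (real v) * (real m * (\<Prod>r\<in>T. 1 - 1 / real r)) \<le> ln (real (Max T)) + 2 * \<beta>"
    by linarith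
qed

end

section \<open>From size estimates to primitive primes\<close>

text \<open>
  The additive constants that arise are \<open>2 \<beta> = 2\<close>, \<open>8/3\<close> and \<open>10/3\<close>. They are covered by \<open>j ln 2\<close> for
  \<open>j = 3, 4, 5\<close>, since \<open>ln 2 \<ge> 2/3\<close>, which leaves inequalities between integers.
\<close>

lemma ln_le_imp_power_le:
  fixes b j N P :: nat and K :: real
  assumes "b > 0" "P > 0" "real N * ln (real b) \<le> ln (real P) + K" "K \<le> real j * ln 2"
  shows "b ^ N \<le> 2 ^ j * P"
proof -
  have "ln (real (b ^ N)) \<le> ln (real (2 ^ j * P))"
    using assms by (simp add: ln_realpow ln_mult)
  hence "real (b ^ N) \<le> real (2 ^ j * P)" using assms(1,2) by (subst (asm) ln_le_cancel_iff) auto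
  thus ?thesis by (simp only: of_nat_le_iff)
qed

lemma prime_minus_one_le_prod:
  fixes T :: "nat set"
  assumes "finite T" "\<And>r. r \<in> T \<Longrightarrow> prime r" "\<Prod>T dvd m" "m > 0" "P \<in> T"
  shows "real (P - 1) \<le> real m * (\<Prod>r\<in>T. 1 - 1 / real r)"
proof -
  have gt: "real r > 1" if "r \<in> T" for r using assms(2)[OF that] prime_gt_1_nat[of r] by simp
  have "real (P - 1) = real P - 1" using gt[OF assms(5)] by (simp add: of_nat_diff)
  also have "\<dots> \<le> (real P - 1) * (\<Prod>r\<in>T - {P}. real r - 1)"
  proof -
    have "(\<Prod>r\<in>T - {P}. real r - 1) \<ge> 1"
    proof (rule prod_ge_1)
      fix r assume "r \<in> T - {P}"
      hence "r \<ge> 2" using assms(2) prime_ge_2_nat by blast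
      thus "1 \<le> real r - 1" by simp
    qed
    thus ?thesis using gt[OF assms(5)] by simp
  qed
  also have "\<dots> = (\<Prod>r\<in>T. real r - 1)" using assms(1,5) by (simp add: prod.remove)
  also have "\<dots> = (\<Prod>r\<in>T. real r * (1 - 1 / real r))"
  proof (rule prod.cong)
    fix r assume "r \<in> T"
    thus "real r - 1 = real r * (1 - 1 / real r)" using gt[of r] by (simp add: field_simps)
  qed simp
  also have "\<dots> = real (\<Prod>T) * (\<Prod>r\<in>T. 1 - 1 / real r)" by (simp add: prod.distrib)
  also have "\<dots> \<le> real m * (\<Prod>r\<in>T. 1 - 1 / real r)"
  proof (rule mult_right_mono)
    show "real (\<Prod>T) \<le> real m" using assms(3,4) by (simp only: of_nat_le_iff dvd_imp_le)
    show "0 \<le> (\<Prod>r\<in>T. 1 - 1 / real r)" using gt by (intro prod_nonneg) force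
  qed
  finally show ?thesis .
qed

lemma linear_less_power:
  fixes P c b :: nat
  assumes "P0 \<le> P" "c * P0 < b ^ (P0 - 1)" "P0 > 0" "b \<ge> 2"
  shows "c * P < b ^ (P - 1)"
  using assms(1)
proof (induction P rule: dec_induct)
  case (step P)
  have "c * Suc P \<le> 2 * (c * P)" using step.hyps assms(3) by simp
  also have "\<dots> < 2 * b ^ (P - 1)" using step.IH by simp
  also have "\<dots> \<le> b * b ^ (P - 1)" using assms(4) by simp
  also have "\<dots> = b ^ (Suc P - 1)" using step.hyps assms(3) by (cases P) auto
  finally show ?case .
qed (use assms in simp)

context aurifeuillian
begin

lemma finite_unramified: "m > 0 \<Longrightarrow> finite (unramified_primes m)"
  unfolding unramified_primes_def by (intro finite_subset[OF _ finite_divisors_nat[of m]]) auto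

lemma primitive_prime_of_numeric_bound:
  fixes \<epsilon> :: int
  assumes "\<epsilon> \<in> {1, -1}" "odd m" "f (\<epsilon> * int v ^ (m div 2)) > 1"
    and \<kappa>: "\<kappa> \<ge> 0"
    and large: "\<And>P. prime P \<Longrightarrow> P dvd m \<Longrightarrow> \<not> P dvd n \<Longrightarrow> real (P - 1) * (\<kappa> * ln (real v)) > ln (real P) + 2 * \<beta>"
  shows "\<exists>p. prime p \<and> p dvd f (\<epsilon> * int v ^ (m div 2)) \<and>
           (\<forall>i. 0 < i \<and> i < n * m \<longrightarrow> \<not> p dvd int v ^ i - 1)"
proof (rule ccontr)
  assume "\<not> ?thesis"
  hence none: "\<And>p. prime p \<Longrightarrow> p dvd f (\<epsilon> * int v ^ (m div 2)) \<Longrightarrow>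
                 \<exists>i. 0 < i \<and> i < n * m \<and> p dvd int v ^ i - 1" by blast
  note bound = no_primitive_prime_bound[OF assms(1-3) none]
  define T where "T = unramified_primes m"
  have m: "m > 0" using assms(2) by (rule odd_pos)
  have T: "finite T" "T \<noteq> {}" using finite_unramified[OF m] bound(1) by (auto simp: T_def)
  have Tp: "prime r" "r dvd m" "\<not> r dvd n" if "r \<in> T" for r
    using that by (auto simp: T_def unramified_primes_def)
  have P: "Max T \<in> T" using T by simp
  have "real (Max T - 1) \<le> real m * (\<Prod>r\<in>T. 1 - 1 / real r)"
    using T Tp P m prod_primes_dvd[OF T(1) Tp(1,2)] by (intro prime_minus_one_le_prod) auto
  hence "real (Max T - 1) * (\<kappa> * ln (real v)) \<le> real m * (\<Prod>r\<in>T. 1 - 1 / real r) * (\<kappa> * ln (real v))"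
    using \<kappa> v by (intro mult_right_mono) auto
  also have "\<dots> \<le> ln (real (Max T)) + 2 * \<beta>"
    using bound(2) by (simp add: T_def mult_ac)
  finally show False using large[OF Tp[OF P]] by simp
qed

end

section \<open>The three factorisations\<close>

text \<open>
  The polynomial \<open>\<Psi>\<^sub>n\<close> is palindromic, so its roots are closed under inversion; in terms of \<open>f\<close> this is
  the assumption \<open>recip\<close>, a relation between the values at \<open>y\<close> and at \<open>1/(v y)\<close>. Modulo \<open>f(x)\<close> the arguments
  belonging to \<open>k\<close> and, with the opposite sign, to \<open>n - k\<close> are related in this way, since the product of
  the \<open>k\<close>-th and the \<open>(n - k)\<close>-th power of \<open>\<surd>v x\<close> is \<open>(v x\<^sup>2)\<^bsup>n/2\<^esup>\<close>, which is \<open>-1\<close>.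
\<close>

lemma factor_dvd_shift_reflect:
  fixes f :: "int \<Rightarrow> int" and v :: int
  assumes half: "\<And>x. f x dvd (v * x\<^sup>2) ^ (n div 2) + 1" and "even n"
    and recip: "\<And>y z. v * y * z - 1 dvd (v * y\<^sup>2) ^ j * f z - f y"
    and "k < n" "odd k" "\<sigma> \<in> {1, -1}"
    and dvd: "f x dvd f (\<sigma> * x * (v * x\<^sup>2) ^ (k div 2))"
  shows "f x dvd f (- \<sigma> * x * (v * x\<^sup>2) ^ ((n - k) div 2))"
proof -
  define q y z where "q = v * x\<^sup>2" and "y = \<sigma> * x * q ^ (k div 2)"
    and "z = - \<sigma> * x * q ^ ((n - k) div 2)"
  have sq: "\<sigma> * \<sigma> = 1" using assms(6) by auto
  obtain a where a: "k = 2 * a + 1" using \<open>odd k\<close> by (rule oddE)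
  have "odd (n - k)" using \<open>even n\<close> \<open>k < n\<close> \<open>odd k\<close> by simp
  then obtain b where b: "n - k = 2 * b + 1" by (rule oddE)
  hence "n = 2 * (a + b + 1)" using a \<open>k < n\<close> by simp
  hence "Suc (k div 2 + (n - k) div 2) = n div 2" "Suc (2 * (k div 2)) = k"
    using a b by simp_all
  hence exps: "q * (q ^ (k div 2) * q ^ ((n - k) div 2)) = q ^ (n div 2)"
      "q * (q ^ (k div 2) * q ^ (k div 2)) = q ^ k"
    by (simp_all flip: power_add power_Suc mult_2)
  have "v * y * z = - ((\<sigma> * \<sigma>) * (q * (q ^ (k div 2) * q ^ ((n - k) div 2))))"
    by (simp add: y_def z_def q_def power2_eq_square mult_ac)
  hence "v * y * z - 1 = - (q ^ (n div 2) + 1)" by (simp add: exps sq)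
  hence "f x dvd v * y * z - 1" using half[of x] by (simp only: q_def dvd_minus_iff)
  hence "f x dvd (v * y\<^sup>2) ^ j * f z - f y" using recip dvd_trans by blast
  moreover have "f x dvd f y" using dvd by (simp add: y_def q_def)
  ultimately have "f x dvd (v * y\<^sup>2) ^ j * f z" by (metis diff_add_cancel dvd_add)
  moreover have "v * y\<^sup>2 = (\<sigma> * \<sigma>) * (q * (q ^ (k div 2) * q ^ (k div 2)))"
    by (simp add: y_def q_def power2_eq_square mult_ac)
  hence "v * y\<^sup>2 = q ^ k" by (simp add: exps sq)
  moreover have "coprime (f x) q"
  proof (rule coprimeI)
    fix c assume c: "c dvd f x" "c dvd q"
    have "n div 2 > 0" using \<open>n = 2 * (a + b + 1)\<close> by simp
    hence "c dvd q ^ (n div 2)" using c(2) by (metis dvd_power dvd_trans)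
    moreover have "c dvd q ^ (n div 2) + 1" using c(1) half[of x] by (metis q_def dvd_trans)
    ultimately show "c dvd 1" by (metis dvd_add_right_iff)
  qed
  ultimately have "f x dvd f z"
    by (simp add: coprime_dvd_mult_right_iff)
  thus ?thesis by (simp add: z_def q_def)
qed

text \<open>
  Modulo \<open>f(x)\<close> one has \<open>(v x\<^sup>2)\<^bsup>n/2\<^esup> = -1\<close>, so replacing \<open>k\<close> by \<open>k + n\<close> merely changes the sign. Together
  with the reflection of \<open>k\<close> to \<open>n - k\<close> this leaves only the \<open>k \<le> n/2\<close> prime to \<open>n\<close>, that is \<open>k = 1\<close>, and
  \<open>k = 5\<close> for \<open>n = 12\<close>.
\<close>

lemma factor_dvd_shift_of_residues:
  fixes f :: "int \<Rightarrow> int" and v :: int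
  assumes cong: "\<And>a b. a - b dvd f a - f b"
    and half: "\<And>x. f x dvd (v * x\<^sup>2) ^ (n div 2) + 1" and "even n"
    and recip: "\<And>y z. v * y * z - 1 dvd (v * y\<^sup>2) ^ j * f z - f y"
    and base: "\<And>k. 2 * k \<le> n \<Longrightarrow> coprime k n \<Longrightarrow> \<exists>\<sigma>\<in>{1, -1}. \<forall>x. f x dvd f (\<sigma> * x * (v * x\<^sup>2) ^ (k div 2))"
    and "n > 0" "coprime k n"
  shows "\<exists>\<sigma>\<in>{1, -1}. \<forall>x. f x dvd f (\<sigma> * x * (v * x\<^sup>2) ^ (k div 2))"
  using \<open>coprime k n\<close>
proof (induction k rule: less_induct)
  case (less k)
  show ?case
  proof (cases "k < n")
    case False
    define j where "j = k - n"
    have k: "k = j + n" using False by (simp add: j_def)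
    have "coprime j n" using less.prems unfolding k coprime_iff_gcd_eq_1 by simp
    then obtain \<sigma> where \<sigma>: "\<sigma> \<in> {1, -1}" "\<And>x. f x dvd f (\<sigma> * x * (v * x\<^sup>2) ^ (j div 2))"
      using less.IH[of j] k \<open>n > 0\<close> by (metis less_add_same_cancel1)
    have "f x dvd f (- \<sigma> * x * (v * x\<^sup>2) ^ (k div 2))" for x
    proof -
      define a where "a = \<sigma> * x * (v * x\<^sup>2) ^ (j div 2)"
      have "k div 2 = j div 2 + n div 2" using \<open>even n\<close> unfolding k by (rule div_plus_div_distrib_dvd_right)
      hence b: "- \<sigma> * x * (v * x\<^sup>2) ^ (k div 2) = - a * (v * x\<^sup>2) ^ (n div 2)"
        by (simp add: a_def power_add)
      have "- a * (v * x\<^sup>2) ^ (n div 2) - a = - a * ((v * x\<^sup>2) ^ (n div 2) + 1)"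
        by (simp add: algebra_simps)
      hence "f x dvd - a * (v * x\<^sup>2) ^ (n div 2) - a" using half[of x] by simp
      hence "f x dvd f (- a * (v * x\<^sup>2) ^ (n div 2)) - f a" using cong dvd_trans by blast
      moreover have "f x dvd f a" using \<sigma>(2) by (simp add: a_def)
      ultimately show ?thesis unfolding b using dvd_diff_right_iff by (metis diff_add_cancel dvd_add)
    qed
    thus ?thesis using \<sigma>(1) by (intro bexI[of _ "-\<sigma>"]) auto
  next
    case True
    show ?thesis
    proof (cases "2 * k \<le> n")
      case False
      have cop: "coprime (n - k) n"
        using less.prems True by (simp add: coprime_iff_gcd_eq_1 gcd_diff2_nat)
      hence odd: "odd (n - k)" using \<open>even n\<close> by (metis coprime_common_divisor odd_one)
      have "k > 0" using odd \<open>even n\<close> by (cases "k = 0") auto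
      hence less: "n - k < n" using \<open>n > 0\<close> by simp
      have "2 * (n - k) \<le> n" using False by simp
      then obtain \<sigma> where \<sigma>: "\<sigma> \<in> {1, -1}"
          "\<And>x. f x dvd f (\<sigma> * x * (v * x\<^sup>2) ^ ((n - k) div 2))"
        using base[OF _ cop] by blast
      have "n - (n - k) = k" using True by simp
      moreover have "f x dvd f (- \<sigma> * x * (v * x\<^sup>2) ^ ((n - (n - k)) div 2))" for x
        by (rule factor_dvd_shift_reflect[where f = f and v = v and j = j,
              OF half \<open>even n\<close> recip less odd \<sigma>])
      ultimately have "f x dvd f (- \<sigma> * x * (v * x\<^sup>2) ^ (k div 2))" for x
        by (simp only:)
      thus ?thesis using \<sigma>(1) by (intro bexI[of _ "- \<sigma>"]) auto
    qed (use base less.prems in blast)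
  qed
qed

text \<open>
  \<open>\<Psi>\<^sub>n(\<surd>v x)\<close> as a polynomial in \<open>x\<close>: the irrational coefficients of \<open>\<Psi>\<^sub>n\<close> are those of the odd powers,
  so only integers remain.
\<close>

definition psi4 :: "int \<Rightarrow> int" where "psi4 x = 2 * x ^ 2 + 2 * x + 1"
definition psi6 :: "int \<Rightarrow> int" where "psi6 x = 3 * x ^ 2 + 3 * x + 1"
definition psi12 :: "int \<Rightarrow> int" where "psi12 x = 4 * x ^ 4 + 4 * x ^ 3 + 2 * x ^ 2 + 2 * x + 1"

lemma ln_bound_of_exp_bounds:
  fixes F q b :: real
  assumes "q > 0" "exp (-b) * q \<le> F" "F \<le> exp b * q"
  shows "\<bar>ln F - ln q\<bar> \<le> b"
proof -
  have "F > 0" using assms by (meson exp_gt_zero less_le_trans mult_pos_pos)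
  hence "ln (exp (-b) * q) \<le> ln F" "ln F \<le> ln (exp b * q)" using assms by simp_all
  thus ?thesis using assms(1) by (simp add: ln_mult)
qed

text \<open>
  The values \<open>1 + y + y\<^sup>2/2\<close>, \<open>1 + y + y\<^sup>2/3\<close> and \<open>1 + y + y\<^sup>2/2 + y\<^sup>3/2 + y\<^sup>4/4\<close> at \<open>y = 1/x\<close>, in this lemma
  and the next two, are the quotients of \<open>f(x)\<close> by \<open>(v x\<^sup>2)\<^bsup>\<kappa>\<^esup>\<close> in the three cases. For \<open>y = -t < 0\<close> the
  lower bound amounts to the product with \<open>exp(\<beta> t)\<close> being at least \<open>1\<close>, where the exponential may be
  replaced by its quadratic Taylor polynomial.
\<close>

lemma exp_bounds_4:
  fixes y :: real
  shows "exp (-\<bar>y\<bar>) \<le> 1 + y + y\<^sup>2 / 2" "1 + y + y\<^sup>2 / 2 \<le> exp \<bar>y\<bar>"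
proof -
  define t where "t = \<bar>y\<bar>"
  have t: "t \<ge> 0" "y = t \<or> y = -t" by (auto simp: t_def)
  have ex: "1 + t + t\<^sup>2 / 2 \<le> exp t" using exp_lower_Taylor_quadratic t by blast
  have pos: "1 - t + t\<^sup>2 / 2 \<ge> 0" using zero_le_power2[of "t - 1"] by (simp add: power2_eq_square algebra_simps)
  have "1 \<le> (1 - t + t\<^sup>2 / 2) * (1 + t + t\<^sup>2 / 2)"
    using zero_le_even_power[of 4 t] by (simp add: algebra_simps power2_eq_square power4_eq_xxxx)
  also have "\<dots> \<le> (1 - t + t\<^sup>2 / 2) * exp t" using ex pos by (intro mult_left_mono)
  finally have lo: "exp (-t) \<le> 1 - t + t\<^sup>2 / 2" by (simp add: exp_minus field_simps)
  show "exp (-\<bar>y\<bar>) \<le> 1 + y + y\<^sup>2 / 2" using t lo by (auto simp: t_def[symmetric])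
  show "1 + y + y\<^sup>2 / 2 \<le> exp \<bar>y\<bar>" using t ex by (auto simp: t_def[symmetric])
qed

lemma exp_bounds_6:
  fixes y :: real
  assumes "\<bar>y\<bar> \<le> 1"
  shows "exp (- (4/3 * \<bar>y\<bar>)) \<le> 1 + y + y\<^sup>2 / 3" "1 + y + y\<^sup>2 / 3 \<le> exp (4/3 * \<bar>y\<bar>)"
proof -
  define t where "t = \<bar>y\<bar>"
  have t: "t \<ge> 0" "t \<le> 1" "y = t \<or> y = -t" using assms by (auto simp: t_def)
  have ex: "1 + (4/3*t) + (4/3*t)\<^sup>2 / 2 \<le> exp (4/3*t)" using exp_lower_Taylor_quadratic t by simp
  have sq: "t\<^sup>2 \<ge> 0" "t\<^sup>2 \<le> t" "t^3 \<le> t" "t^4 \<ge> 0"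
    using t power_decreasing[of 1 2 t] power_decreasing[of 1 3 t] by auto
  have pos: "1 - t + t\<^sup>2 / 3 \<ge> 0" using t sq by linarith
  have "(1 - t + t\<^sup>2 / 3) * (1 + 4/3*t + (4/3*t)\<^sup>2 / 2) = 1 + t * (1/3 - t/9 - 4/9 * t\<^sup>2 + 8/27 * t^3)"
    by (simp add: field_simps power2_eq_square power3_eq_cube)
  moreover have "1/3 - t/9 - 4/9 * t\<^sup>2 + 8/27 * t^3 \<ge> 0"
  proof -
    \<comment> \<open>Expansion in the Bernstein basis, whose coefficients turn out to be positive.\<close>
    have "1/3 - t/9 - 4/9 * t\<^sup>2 + 8/27 * t^3 =
        1/3 * (1 - t)^3 + 8/9 * (t * (1 - t)^2) + 1/3 * (t\<^sup>2 * (1 - t)) + 2/27 * t^3"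
      by (simp add: field_simps power2_eq_square power3_eq_cube)
    also have "\<dots> \<ge> 0" using t by simp
    finally show ?thesis .
  qed
  ultimately have "1 \<le> (1 - t + t\<^sup>2 / 3) * (1 + 4/3*t + (4/3*t)\<^sup>2 / 2)" using t by simp
  also have "\<dots> \<le> (1 - t + t\<^sup>2 / 3) * exp (4/3*t)" using ex pos by (intro mult_left_mono)
  finally have lo: "exp (-(4/3*t)) \<le> 1 - t + t\<^sup>2 / 3" by (simp add: exp_minus field_simps)
  have "1 + t + t\<^sup>2 / 3 \<le> 1 + (4/3*t) + (4/3*t)\<^sup>2 / 2"
  proof -
    have "(4/3*t)\<^sup>2 = 16/9 * t\<^sup>2" by (simp add: power2_eq_square)
    thus ?thesis using t sq by linarith
  qed
  hence hi: "1 + t + t\<^sup>2 / 3 \<le> exp (4/3*t)" using ex by linarith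
  have "1 - t + t\<^sup>2 / 3 \<le> 1" "1 + t + t\<^sup>2 / 3 \<ge> 1" 
    using t sq by linarith+
  moreover have "exp (-(4/3*t)) \<le> 1" "exp (4/3*t) \<ge> 1" using t by auto
  ultimately have "exp (-(4/3*t)) \<le> 1 + y + y\<^sup>2 / 3 \<and> 1 + y + y\<^sup>2 / 3 \<le> exp (4/3*t)"
    using t(3) lo hi by auto
  thus "exp (- (4/3 * \<bar>y\<bar>)) \<le> 1 + y + y\<^sup>2 / 3" "1 + y + y\<^sup>2 / 3 \<le> exp (4/3 * \<bar>y\<bar>)"
    by (auto simp: t_def)
qed

lemma exp_bounds_12:
  fixes y :: real
  assumes "\<bar>y\<bar> \<le> 1"
  shows "exp (- (5/3 * \<bar>y\<bar>)) \<le> 1 + y + y\<^sup>2 / 2 + y^3 / 2 + y^4 / 4"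
    "1 + y + y\<^sup>2 / 2 + y^3 / 2 + y^4 / 4 \<le> exp (5/3 * \<bar>y\<bar>)"
proof -
  define t where "t = \<bar>y\<bar>"
  have t: "t \<ge> 0" "t \<le> 1" "y = t \<or> y = -t" using assms by (auto simp: t_def)
  have ex: "1 + (5/3*t) + (5/3*t)\<^sup>2 / 2 \<le> exp (5/3*t)" using exp_lower_Taylor_quadratic t by simp
  have sq: "t\<^sup>2 \<ge> 0" "t\<^sup>2 \<le> t" "t^3 \<le> t" "t^4 \<le> t" "t^3 \<ge> 0" "t^4 \<ge> 0" "t^3 \<le> t\<^sup>2"
    using t power_decreasing[of 1 2 t] power_decreasing[of 1 3 t] power_decreasing[of 1 4 t]
      power_decreasing[of 2 3 t] by auto
  define g where "g = 1 - t + t\<^sup>2 / 2 - t^3 / 2 + t^4 / 4"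
  have "g = (1 - t) * (1 + t\<^sup>2 / 2) + t^4 / 4"
    by (simp add: g_def field_simps power2_eq_square power3_eq_cube)
  hence pos: "g \<ge> 0" using t by simp
  have "g * (1 + 5/3*t + (5/3*t)\<^sup>2 / 2) =
     1 + t / 72 * (48 + 16*t - 76*t\<^sup>2 + 8*t^3 - 20*t^4 + 25*t^5)"
    by (simp add: g_def field_simps eval_nat_numeral)
  moreover have "48 + 16*t - 76*t\<^sup>2 + 8*t^3 - 20*t^4 + 25*t^5 \<ge> 0"
  proof -
    \<comment> \<open>Again the Bernstein basis, of degree 5.\<close>
    have "48 + 16*t - 76*t\<^sup>2 + 8*t^3 - 20*t^4 + 25*t^5 =
        48 * (1 - t)^5 + 256 * (t * (1 - t)^4) + 468 * (t\<^sup>2 * (1 - t)^3)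
        + 356 * (t^3 * (1 - t)^2) + 72 * (t^4 * (1 - t)) + t^5"
      by (simp add: field_simps eval_nat_numeral)
    also have "\<dots> \<ge> 0" using t by simp
    finally show ?thesis .
  qed
  ultimately have "1 \<le> g * (1 + 5/3*t + (5/3*t)\<^sup>2 / 2)" using t by simp
  also have "\<dots> \<le> g * exp (5/3*t)" using ex pos by (intro mult_left_mono)
  finally have lo: "exp (-(5/3*t)) \<le> g" by (simp add: exp_minus field_simps)
  have "1 + t + t\<^sup>2 / 2 + t^3 / 2 + t^4 / 4 \<le> 1 + (5/3*t) + (5/3*t)\<^sup>2 / 2"
  proof -
    have "(5/3*t)\<^sup>2 = 25/9 * t\<^sup>2" by (simp add: power2_eq_square)
    thus ?thesis using t sq by linarith
  qed
  hence hi: "1 + t + t\<^sup>2 / 2 + t^3 / 2 + t^4 / 4 \<le> exp (5/3*t)" using ex by linarith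
  have "g \<le> 1" "1 + t + t\<^sup>2 / 2 + t^3 / 2 + t^4 / 4 \<ge> 1" 
    using t sq unfolding g_def by linarith+
  moreover have "exp (-(5/3*t)) \<le> 1" "exp (5/3*t) \<ge> 1" using t by auto
  ultimately have bounds: "exp (-(5/3*t)) \<le> g" "g \<le> exp (5/3*t)"
    "exp (-(5/3*t)) \<le> 1 + t + t\<^sup>2 / 2 + t^3 / 2 + t^4 / 4"
    "1 + t + t\<^sup>2 / 2 + t^3 / 2 + t^4 / 4 \<le> exp (5/3*t)"
    using lo hi by linarith+
  have "y = - t \<Longrightarrow> 1 + y + y\<^sup>2 / 2 + y^3 / 2 + y^4 / 4 = g" by (simp add: g_def)
  hence "exp (-(5/3*t)) \<le> 1 + y + y\<^sup>2 / 2 + y^3 / 2 + y^4 / 4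
     \<and> 1 + y + y\<^sup>2 / 2 + y^3 / 2 + y^4 / 4 \<le> exp (5/3*t)"
    using t(3) bounds by metis
  thus "exp (- (5/3 * \<bar>y\<bar>)) \<le> 1 + y + y\<^sup>2 / 2 + y^3 / 2 + y^4 / 4"
    "1 + y + y\<^sup>2 / 2 + y^3 / 2 + y^4 / 4 \<le> exp (5/3 * \<bar>y\<bar>)"
    by (auto simp: t_def)
qed

lemma prime_not_dvd_2:
  fixes p a :: int
  assumes "prime p" "p dvd a" "odd a" shows "\<not> p dvd 2"
proof
  assume "p dvd 2"
  hence "p = 2" using assms(1) primes_dvd_imp_eq[of p 2] by simp
  thus False using assms(2,3) by simp
qed

lemma prime_not_dvd_3:
  fixes p a :: int
  assumes "prime p" "p dvd a" "3 dvd a - 1" shows "\<not> p dvd 3"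
proof
  assume "p dvd 3"
  hence "p = 3" using assms(1) primes_dvd_imp_eq[of p 3] by simp
  hence "3 dvd a - (a - 1)" using assms(2,3) by (metis dvd_diff)
  thus False by simp
qed

lemma psi4_times_conjugate: "psi4 x * psi4 (- x) = (2 * x\<^sup>2) ^ 2 + 1"
  by (simp add: psi4_def algebra_simps eval_nat_numeral)

lemma psi6_times_conjugate: "psi6 x * psi6 (- x) = (3 * x\<^sup>2) ^ 2 - 3 * x\<^sup>2 + 1"
  by (simp add: psi6_def algebra_simps eval_nat_numeral)

lemma psi12_times_conjugate: "psi12 x * psi12 (- x) = (2 * x\<^sup>2) ^ 4 - (2 * x\<^sup>2) ^ 2 + 1"
  by (simp add: psi12_def algebra_simps eval_nat_numeral)

lemma psi12_cong: "a - b dvd psi12 a - psi12 b"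
  by (rule dvdI[of _ _ "4 * (a ^ 3 + a ^ 2 * b + a * b ^ 2 + b ^ 3) + 4 * (a ^ 2 + a * b + b ^ 2) + 2 * (a + b) + 2"])
     (simp add: psi12_def algebra_simps eval_nat_numeral)

lemma three_dvd_psi12_minus_1: "3 dvd psi12 x - 1"
proof -
  have "3 dvd x - x mod 3" by (simp add: dvd_minus_mod)
  hence "3 dvd psi12 x - psi12 (x mod 3)" using psi12_cong dvd_trans by blast
  moreover have "x mod 3 = 0 \<or> x mod 3 = 1 \<or> x mod 3 = 2" by presburger
  hence "3 dvd psi12 (x mod 3) - 1" by (auto simp: psi12_def)
  ultimately have "3 dvd (psi12 x - psi12 (x mod 3)) + (psi12 (x mod 3) - 1)" by (rule dvd_add)
  thus ?thesis by simp
qed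

text \<open>
  Here and in the two interpretations that follow, the claims about primes rest on combinations of \<open>f(x)\<close>, \<open>f(-x)\<close>
  and \<open>(v x\<^sup>2)\<^bsup>n/l\<^esup> - 1\<close> equal to \<open>2\<close> or \<open>3\<close>, together with the fact that \<open>f(x)\<close> is odd and, for
  \<open>3\<close> dividing \<open>n\<close>, congruent to \<open>1\<close> modulo \<open>3\<close>.
\<close>

interpretation Psi4: aurifeuillian 2 4 psi4 "\<lambda>x. (2 * x\<^sup>2)\<^sup>2 - 1" 1 1
proof
  fix x :: int
  have "q ^ 4 - 1 = (q ^ 2 + 1) * (q\<^sup>2 - 1)" for q :: int
    by (simp add: algebra_simps eval_nat_numeral)
  thus "(int 2 * x\<^sup>2) ^ 4 - 1 = psi4 x * psi4 (- x) * ((2 * x\<^sup>2)\<^sup>2 - 1)"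
    by (simp only: of_nat_numeral psi4_times_conjugate)
  have "psi4 x = x\<^sup>2 + (x + 1)\<^sup>2" by (simp add: psi4_def power2_eq_square algebra_simps)
  thus "psi4 x > 0" by (cases "x = 0") (auto intro: add_pos_nonneg)
  fix p :: int assume p: "prime p"
  show "\<exists>l. prime l \<and> l dvd 4 \<and> p dvd (int 2 * x\<^sup>2) ^ (4 div l) - 1" if "p dvd (2 * x\<^sup>2)\<^sup>2 - 1"
    using that by (intro exI[of _ 2]) auto
  assume px: "p dvd psi4 x"
  have n2: "\<not> p dvd 2" using p px by (rule prime_not_dvd_2) (simp add: psi4_def)
  show "\<not> p dvd (int 2 * x\<^sup>2) ^ (4 div l) - 1" if l: "prime l" "l dvd 4" for l :: nat
  proof
    have "l dvd 2 ^ 2" using l by simp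
    hence "l = 2" using l(1) prime_dvd_power primes_dvd_imp_eq two_is_prime_nat by blast
    moreover assume "p dvd (int 2 * x\<^sup>2) ^ (4 div l) - 1"
    ultimately have "p dvd (2 * x\<^sup>2)\<^sup>2 - 1" by simp
    moreover have "psi4 x * psi4 (-x) - ((2 * x\<^sup>2)\<^sup>2 - 1) = 2"
      by (simp add: psi4_def algebra_simps eval_nat_numeral)
    ultimately show False using px n2 by (metis dvd_diff dvd_mult2)
  qed
  show "\<not> p dvd psi4 (-x)"
  proof
    assume "p dvd psi4 (-x)"
    moreover have "psi4 x * (1 - x) + psi4 (-x) * (1 + x) = 2"
      by (simp add: psi4_def algebra_simps eval_nat_numeral)
    ultimately show False using px n2 by (metis dvd_add dvd_mult2)
  qed
next
  fix k :: nat assume "coprime k 4"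
  thus "\<exists>\<sigma>\<in>{1, -1}. \<forall>x. psi4 x dvd psi4 (\<sigma> * x * (int 2 * x\<^sup>2) ^ (k div 2))"
  proof (rule factor_dvd_shift_of_residues[rotated -1])
    show "a - b dvd psi4 a - psi4 b" for a b
      by (rule dvdI[of _ _ "2 * (a + b) + 2"]) (simp add: psi4_def algebra_simps eval_nat_numeral)
    show "psi4 x dvd (int 2 * x\<^sup>2) ^ (4 div 2) + 1" for x
    proof -
      have "psi4 x dvd (2 * x\<^sup>2) ^ 2 + 1"
        by (rule dvdI[of _ _ "psi4 (-x)"]) (simp add: psi4_def algebra_simps eval_nat_numeral)
      thus ?thesis by simp
    qed
    show "int 2 * y * z - 1 dvd (int 2 * y\<^sup>2) ^ 1 * psi4 z - psi4 y" for y z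
      by (rule dvdI[of _ _ "2 * y * z + 1 + 2 * y"])
         (simp add: psi4_def algebra_simps eval_nat_numeral)
    fix k :: nat assume k: "2 * k \<le> 4" "coprime k 4"
    hence "k = 1" using coprime_common_divisor[OF k(2), of 2]
      by (cases "k = 0 \<or> k = 2") auto
    thus "\<exists>\<sigma>\<in>{1, -1}. \<forall>x. psi4 x dvd psi4 (\<sigma> * x * (int 2 * x\<^sup>2) ^ (k div 2))"
      by (intro bexI[of _ 1]) auto
  qed auto
next
  fix x :: int assume x: "x \<noteq> 0"
  define y where "y = 1 / real_of_int x"
  have "real_of_int (psi4 x) = (1 + y + y\<^sup>2 / 2) * real_of_int (int 2 * x\<^sup>2)"
    using x by (simp add: psi4_def y_def field_simps power2_eq_square)
  moreover have "real_of_int (int 2 * x\<^sup>2) > 0" using x by simp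
  ultimately have "\<bar>ln (real_of_int (psi4 x)) - ln (real_of_int (int 2 * x\<^sup>2))\<bar> \<le> \<bar>y\<bar>"
    using exp_bounds_4[of y] by (intro ln_bound_of_exp_bounds) (auto intro!: mult_right_mono)
  thus "\<bar>ln (real_of_int (psi4 x)) - 1 * ln (real_of_int (int 2 * x\<^sup>2))\<bar> \<le> 1 / \<bar>real_of_int x\<bar>"
    by (simp add: y_def)
qed auto

interpretation Psi6: aurifeuillian 3 6 psi6 "\<lambda>x. ((3 * x\<^sup>2) ^ 3 - 1) * (3 * x\<^sup>2 + 1)" 1 "4/3"
proof
  fix x :: int
  have "q ^ 6 - 1 = (q ^ 2 - q + 1) * ((q ^ 3 - 1) * (q + 1))" for q :: int
    by (simp add: algebra_simps eval_nat_numeral)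
  thus "(int 3 * x\<^sup>2) ^ 6 - 1 = psi6 x * psi6 (- x) * (((3 * x\<^sup>2) ^ 3 - 1) * (3 * x\<^sup>2 + 1))"
    by (simp only: of_nat_numeral psi6_times_conjugate)
  have "4 * psi6 x = 3 * (2 * x + 1)\<^sup>2 + 1" by (simp add: psi6_def power2_eq_square algebra_simps)
  moreover have "(2 * x + 1)\<^sup>2 \<ge> 0" by simp
  ultimately show "psi6 x > 0" by linarith
  fix p :: int assume p: "prime p"
  show "\<exists>l. prime l \<and> l dvd 6 \<and> p dvd (int 3 * x\<^sup>2) ^ (6 div l) - 1" if R: "p dvd ((3 * x\<^sup>2) ^ 3 - 1) * (3 * x\<^sup>2 + 1)"
  proof -
    have "(3 * x\<^sup>2) ^ 2 - 1 = (3 * x\<^sup>2 - 1) * (3 * x\<^sup>2 + 1)"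
      by (simp add: algebra_simps eval_nat_numeral)
    hence "p dvd (3 * x\<^sup>2) ^ 3 - 1 \<or> p dvd (3 * x\<^sup>2) ^ 2 - 1"
      using R p by (metis dvd_mult prime_dvd_mult_iff)
    thus ?thesis
    proof
      assume "p dvd (3 * x\<^sup>2) ^ 3 - 1"
      thus ?thesis by (intro exI[of _ 2]) auto
    next
      assume "p dvd (3 * x\<^sup>2) ^ 2 - 1"
      thus ?thesis by (intro exI[of _ 3]) auto
    qed
  qed
  assume px: "p dvd psi6 x"
  have n2: "\<not> p dvd 2" using p px by (rule prime_not_dvd_2) (simp add: psi6_def)
  have n3: "\<not> p dvd 3" using p px
    by (rule prime_not_dvd_3) (simp add: psi6_def)
  show "\<not> p dvd (int 3 * x\<^sup>2) ^ (6 div l) - 1" if l: "prime l" "l dvd 6" for l :: nat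
  proof
    assume pl: "p dvd (int 3 * x\<^sup>2) ^ (6 div l) - 1"
    have "l dvd 2 * 3" using l by simp
    hence "l dvd 2 \<or> l dvd 3" using l(1) by (metis prime_dvd_mult_iff)
    hence "l = 2 \<or> l = 3" using l(1) primes_dvd_imp_eq[of l 2] primes_dvd_imp_eq[of l 3] by auto
    thus False
    proof
      assume "l = 2"
      hence "p dvd (3 * x\<^sup>2) ^ 3 - 1" using pl by simp
      moreover have "psi6 x * (psi6 (-x) * (3 * x\<^sup>2 + 1)) - ((3 * x\<^sup>2) ^ 3 - 1) = 2"
        by (simp add: psi6_def algebra_simps eval_nat_numeral)
      ultimately show False using px n2 by (metis dvd_diff dvd_mult2)
    next
      assume "l = 3"
      hence "p dvd (3 * x\<^sup>2) ^ 2 - 1" using pl by simp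
      moreover have "psi6 x * (psi6 (-x) * (3 * x\<^sup>2 + 2)) - ((3 * x\<^sup>2) ^ 2 - 1) * (3 * x\<^sup>2 + 1) = 3"
        by (simp add: psi6_def algebra_simps eval_nat_numeral)
      ultimately show False using px n3 by (metis dvd_diff dvd_mult2)
    qed
  qed
  show "\<not> p dvd psi6 (-x)"
  proof
    assume "p dvd psi6 (-x)"
    moreover have "psi6 x * (1 - x) + psi6 (-x) * (1 + x) = 2"
      by (simp add: psi6_def algebra_simps eval_nat_numeral)
    ultimately show False using px n2 by (metis dvd_add dvd_mult2)
  qed
next
  fix k :: nat assume "coprime k 6"
  thus "\<exists>\<sigma>\<in>{1, -1}. \<forall>x. psi6 x dvd psi6 (\<sigma> * x * (int 3 * x\<^sup>2) ^ (k div 2))"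
  proof (rule factor_dvd_shift_of_residues[rotated -1])
    show "a - b dvd psi6 a - psi6 b" for a b
      by (rule dvdI[of _ _ "3 * (a + b) + 3"]) (simp add: psi6_def algebra_simps eval_nat_numeral)
    show "psi6 x dvd (int 3 * x\<^sup>2) ^ (6 div 2) + 1" for x
    proof -
      have "psi6 x dvd (3 * x\<^sup>2) ^ 3 + 1"
        by (rule dvdI[of _ _ "psi6 (-x) * (3 * x\<^sup>2 + 1)"]) (simp add: psi6_def algebra_simps eval_nat_numeral)
      thus ?thesis by simp
    qed
    show "int 3 * y * z - 1 dvd (int 3 * y\<^sup>2) ^ 1 * psi6 z - psi6 y" for y z
      by (rule dvdI[of _ _ "3 * y * z + 1 + 3 * y"])
         (simp add: psi6_def algebra_simps eval_nat_numeral)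
    fix k :: nat assume k: "2 * k \<le> 6" "coprime k 6"
    hence "k = 1" using coprime_common_divisor[OF k(2), of 2] coprime_common_divisor[OF k(2), of 3]
      by (cases "k = 0 \<or> k = 2 \<or> k = 3") auto
    thus "\<exists>\<sigma>\<in>{1, -1}. \<forall>x. psi6 x dvd psi6 (\<sigma> * x * (int 3 * x\<^sup>2) ^ (k div 2))"
      by (intro bexI[of _ 1]) auto
  qed auto
next
  fix x :: int assume x: "x \<noteq> 0"
  define y where "y = 1 / real_of_int x"
  have "\<bar>real_of_int x\<bar> \<ge> 1" using x by linarith
  hence y: "\<bar>y\<bar> \<le> 1" by (simp add: y_def)
  have "real_of_int (psi6 x) = (1 + y + y\<^sup>2 / 3) * real_of_int (int 3 * x\<^sup>2)"
    using x by (simp add: psi6_def y_def field_simps eval_nat_numeral)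
  moreover have "real_of_int (int 3 * x\<^sup>2) > 0" using x by simp
  ultimately have "\<bar>ln (real_of_int (psi6 x)) - ln (real_of_int (int 3 * x\<^sup>2))\<bar> \<le> 4/3 * \<bar>y\<bar>"
    using exp_bounds_6[OF y] by (intro ln_bound_of_exp_bounds) (auto intro!: mult_right_mono)
  thus "\<bar>ln (real_of_int (psi6 x)) - 1 * ln (real_of_int (int 3 * x\<^sup>2))\<bar> \<le> 4/3 / \<bar>real_of_int x\<bar>"
    using x by (simp add: y_def ln_realpow)
qed auto

interpretation Psi12: aurifeuillian 2 12 psi12 "\<lambda>x. ((2 * x\<^sup>2) ^ 6 - 1) * ((2 * x\<^sup>2)\<^sup>2 + 1)" 2 "5/3"
proof
  fix x :: int
  have "q ^ 12 - 1 = (q ^ 4 - q ^ 2 + 1) * ((q ^ 6 - 1) * (q\<^sup>2 + 1))" for q :: int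
    by (simp add: algebra_simps eval_nat_numeral)
  thus "(int 2 * x\<^sup>2) ^ 12 - 1 = psi12 x * psi12 (- x) * (((2 * x\<^sup>2) ^ 6 - 1) * ((2 * x\<^sup>2)\<^sup>2 + 1))"
    by (simp only: of_nat_numeral psi12_times_conjugate)
  have "psi12 x = (2 * x\<^sup>2 + x)\<^sup>2 + (x + 1)\<^sup>2" by (simp add: psi12_def algebra_simps eval_nat_numeral)
  thus "psi12 x > 0" by (cases "x = - 1") (auto intro: add_nonneg_pos)
  fix p :: int assume p: "prime p"
  show "\<exists>l. prime l \<and> l dvd 12 \<and> p dvd (int 2 * x\<^sup>2) ^ (12 div l) - 1" if R: "p dvd ((2 * x\<^sup>2) ^ 6 - 1) * ((2 * x\<^sup>2)\<^sup>2 + 1)"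
  proof -
    have "(2 * x\<^sup>2) ^ 4 - 1 = ((2 * x\<^sup>2)\<^sup>2 - 1) * ((2 * x\<^sup>2)\<^sup>2 + 1)"
      by (simp add: algebra_simps eval_nat_numeral)
    hence "p dvd (2 * x\<^sup>2) ^ 6 - 1 \<or> p dvd (2 * x\<^sup>2) ^ 4 - 1"
      using R p by (metis dvd_mult prime_dvd_mult_iff)
    thus ?thesis
    proof
      assume "p dvd (2 * x\<^sup>2) ^ 6 - 1"
      thus ?thesis by (intro exI[of _ 2]) auto
    next
      assume "p dvd (2 * x\<^sup>2) ^ 4 - 1"
      thus ?thesis by (intro exI[of _ 3]) auto
    qed
  qed
  assume px: "p dvd psi12 x"
  have n2: "\<not> p dvd 2" using p px by (rule prime_not_dvd_2) (simp add: psi12_def)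
  have n3: "\<not> p dvd 3" using p px
    by (rule prime_not_dvd_3) (rule three_dvd_psi12_minus_1)
  show "\<not> p dvd (int 2 * x\<^sup>2) ^ (12 div l) - 1" if l: "prime l" "l dvd 12" for l :: nat
  proof
    assume pl: "p dvd (int 2 * x\<^sup>2) ^ (12 div l) - 1"
    have "l dvd 2 * 2 * 3" using l by simp
    hence "l dvd 2 \<or> l dvd 3" using l(1) by (metis prime_dvd_mult_iff)
    hence "l = 2 \<or> l = 3" using l(1) primes_dvd_imp_eq[of l 2] primes_dvd_imp_eq[of l 3] by auto
    thus False
    proof
      assume "l = 2"
      hence "p dvd (2 * x\<^sup>2) ^ 6 - 1" using pl by simp
      moreover have "psi12 x * (psi12 (-x) * ((2 * x\<^sup>2)\<^sup>2 + 1)) - ((2 * x\<^sup>2) ^ 6 - 1) = 2"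
        by (simp add: psi12_def algebra_simps eval_nat_numeral)
      ultimately show False using px n2 by (metis dvd_diff dvd_mult2)
    next
      assume "l = 3"
      hence "p dvd (2 * x\<^sup>2) ^ 4 - 1" using pl by simp
      moreover have "psi12 x * (psi12 (-x) * ((2 * x\<^sup>2)\<^sup>2 + 2)) - ((2 * x\<^sup>2) ^ 4 - 1) * ((2 * x\<^sup>2)\<^sup>2 + 1) = 3"
        by (simp add: psi12_def algebra_simps eval_nat_numeral)
      ultimately show False using px n3 by (metis dvd_diff dvd_mult2)
    qed
  qed
  show "\<not> p dvd psi12 (-x)"
  proof
    assume "p dvd psi12 (-x)"
    moreover have "psi12 x * (1 - x) + psi12 (-x) * (1 + x) = 2"
      by (simp add: psi12_def algebra_simps eval_nat_numeral)
    ultimately show False using px n2 by (metis dvd_add dvd_mult2)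
  qed
next
  fix k :: nat assume "coprime k 12"
  thus "\<exists>\<sigma>\<in>{1, -1}. \<forall>x. psi12 x dvd psi12 (\<sigma> * x * (int 2 * x\<^sup>2) ^ (k div 2))"
  proof (rule factor_dvd_shift_of_residues[rotated -1])
    show "a - b dvd psi12 a - psi12 b" for a b
      by (rule psi12_cong)
    show "psi12 x dvd (int 2 * x\<^sup>2) ^ (12 div 2) + 1" for x
    proof -
      have "psi12 x dvd (2 * x\<^sup>2) ^ 6 + 1"
        by (rule dvdI[of _ _ "psi12 (-x) * ((2 * x\<^sup>2)\<^sup>2 + 1)"]) (simp add: psi12_def algebra_simps eval_nat_numeral)
      thus ?thesis by simp
    qed
    show "int 2 * y * z - 1 dvd (int 2 * y\<^sup>2) ^ 2 * psi12 z - psi12 y" for y z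
      by (rule dvdI[of _ _ "(2 * y * z) ^ 3 + (2 * y * z) ^ 2 + 2 * y * z + 1 + 2 * y * ((2 * y * z) ^ 2 + 2 * y * z + 1) + 2 * y ^ 2 * (2 * y * z + 1) + 4 * y ^ 3"])
         (simp add: psi12_def algebra_simps eval_nat_numeral)
    fix k :: nat assume k: "2 * k \<le> 12" "coprime k 12"
    have "\<not> 2 dvd k" "\<not> 3 dvd k"
      using coprime_common_divisor[OF k(2), of 2] coprime_common_divisor[OF k(2), of 3] by auto
    with k(1) have "k = 1 \<or> k = 5" by presburger
    then consider "k = 1" | "k = 5" by blast
    thus "\<exists>\<sigma>\<in>{1, -1}. \<forall>x. psi12 x dvd psi12 (\<sigma> * x * (int 2 * x\<^sup>2) ^ (k div 2))"
    proof cases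
      case 2
      have "psi12 x dvd psi12 (- 1 * x * (2 * x\<^sup>2) ^ 2)" for x
        by (rule dvdI[of _ _ "1 - 2 * x ^ 1 + 2 * x ^ 2 - 4 * x ^ 3 + 8 * x ^ 4 - 16 * x ^ 5 + 24 * x ^ 6 - 32 * x ^ 7
              + 48 * x ^ 8 - 64 * x ^ 9 + 96 * x ^ 10 - 128 * x ^ 11 + 128 * x ^ 12 - 128 * x ^ 13
              + 128 * x ^ 14 - 256 * x ^ 15 + 256 * x ^ 16"])
           (simp add: psi12_def algebra_simps eval_nat_numeral)
      thus ?thesis using 2 by (intro bexI[of _ "-1"]) auto
    qed auto
  qed auto
next
  fix x :: int assume x: "x \<noteq> 0"
  define y where "y = 1 / real_of_int x"
  have "\<bar>real_of_int x\<bar> \<ge> 1" using x by linarith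
  hence y: "\<bar>y\<bar> \<le> 1" by (simp add: y_def)
  have "real_of_int (psi12 x) = (1 + y + y\<^sup>2 / 2 + y ^ 3 / 2 + y ^ 4 / 4) * real_of_int (int 2 * x\<^sup>2) ^ 2"
    using x by (simp add: psi12_def y_def field_simps eval_nat_numeral)
  moreover have "real_of_int (int 2 * x\<^sup>2) ^ 2 > 0" using x by simp
  ultimately have "\<bar>ln (real_of_int (psi12 x)) - ln (real_of_int (int 2 * x\<^sup>2) ^ 2)\<bar> \<le> 5/3 * \<bar>y\<bar>"
    using exp_bounds_12[OF y] by (intro ln_bound_of_exp_bounds) (auto intro!: mult_right_mono)
  moreover have "ln (real_of_int (int 2 * x\<^sup>2) ^ 2) = 2 * ln (real_of_int (int 2 * x\<^sup>2))"
    using x by (subst ln_realpow) auto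
  moreover have "5/3 * \<bar>y\<bar> = 5/3 / \<bar>real_of_int x\<bar>" by (simp add: y_def)
  ultimately show "\<bar>ln (real_of_int (psi12 x)) - 2 * ln (real_of_int (int 2 * x\<^sup>2))\<bar> \<le> 5/3 / \<bar>real_of_int x\<bar>"
    by linarith
qed auto

section \<open>Primitive primes in the three families\<close>

lemma prime_ge_5_if_not_dvd_6:
  fixes P :: nat
  assumes "prime P" "\<not> P dvd 6"
  shows "P \<ge> 5"
proof (rule ccontr)
  assume "\<not> P \<ge> 5"
  hence "P = 0 \<or> P = 1 \<or> P = 2 \<or> P = 3 \<or> P = 4" by auto
  moreover have "\<not> prime (4::nat)" by (simp add: prime_nat_iff) (auto intro!: exI[of _ 2])
  ultimately show False using assms by auto
qed

lemma signed_power_times_succ_pos: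
  fixes v m :: nat and \<epsilon> :: int
  assumes "v > 1" "odd m" "m > 1" "\<epsilon> \<in> {1, -1}"
  defines "x \<equiv> \<epsilon> * int v ^ (m div 2)"
  shows "x * (x + 1) > 0"
proof -
  have "m div 2 > 0" using assms(3) by simp
  hence "int v ^ (m div 2) > 1" using assms(1) by simp
  hence "x > 0 \<or> x < -1" using assms(1,4) by (auto simp: x_def)
  thus ?thesis by (auto intro: mult_pos_pos mult_neg_neg)
qed

lemma primitive_prime_6:
  fixes \<epsilon> :: int
  assumes "\<epsilon> \<in> {1, -1}" "odd m" "m > 1"
  shows "\<exists>p. prime p \<and> p dvd psi6 (\<epsilon> * 3 ^ (m div 2)) \<and>
           (\<forall>i. 0 < i \<and> i < 6 * m \<longrightarrow> \<not> p dvd 3 ^ i - 1)"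
proof -
  have big: "psi6 (\<epsilon> * int 3 ^ (m div 2)) > 1"
    using signed_power_times_succ_pos[of 3 m \<epsilon>] assms
    by (simp add: psi6_def power2_eq_square algebra_simps)
  have "ln (real P) + 2 * (4/3) < real (P - 1) * (1 * ln (real 3))" if P: "prime P" "\<not> P dvd 6" for P
  proof (rule ccontr)
    have "P \<ge> 5" using P by (rule prime_ge_5_if_not_dvd_6)
    hence "16 * P < 3 ^ (P - 1)" by (rule linear_less_power) auto
    moreover assume "\<not> ?thesis"
    hence "3 ^ (P - 1) \<le> 2 ^ 4 * P"
      using \<open>P \<ge> 5\<close> ln2_ge_two_thirds by (intro ln_le_imp_power_le[of _ _ _ "8/3"]) auto
    ultimately show False by simp
  qed
  thus ?thesis using Psi6.primitive_prime_of_numeric_bound[OF assms(1,2) big] by simp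
qed

lemma primitive_prime_12:
  fixes \<epsilon> :: int
  assumes "\<epsilon> \<in> {1, -1}" "odd m" "m > 1"
  shows "\<exists>p. prime p \<and> p dvd psi12 (\<epsilon> * 2 ^ (m div 2)) \<and>
           (\<forall>i. 0 < i \<and> i < 12 * m \<longrightarrow> \<not> p dvd 2 ^ i - 1)"
proof -
  define x where "x = \<epsilon> * 2 ^ (m div 2)"
  have "x * (x + 1) > 0" using signed_power_times_succ_pos[of 2 m \<epsilon>] assms by (simp add: x_def)
  moreover have "2 * x\<^sup>2 + 1 > 0" using zero_le_power2[of x] by linarith
  ultimately have "(x * (x + 1)) * (2 * x\<^sup>2 + 1) > 0" by (rule mult_pos_pos)
  moreover have "psi12 x = 2 * ((x * (x + 1)) * (2 * x\<^sup>2 + 1)) + 1"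
    by (simp add: psi12_def algebra_simps eval_nat_numeral)
  ultimately have "psi12 x > 1" by linarith
  hence big: "psi12 (\<epsilon> * int 2 ^ (m div 2)) > 1" by (simp add: x_def)
  have "ln (real P) + 2 * (5/3) < real (P - 1) * (2 * ln (real 2))" if P: "prime P" "\<not> P dvd 12" for P
  proof (rule ccontr)
    have "\<not> P dvd 6" using P(2) by (metis dvd_mult numeral_Bit0_eq_double)
    hence P5: "P \<ge> 5" using P(1) by (rule prime_ge_5_if_not_dvd_6[rotated])
    hence "32 * P < 4 ^ (P - 1)" by (rule linear_less_power) auto
    moreover assume "\<not> ?thesis"
    moreover have "ln (real 4) = 2 * ln (2::real)" using ln_realpow[of 2 2] by simp
    ultimately have "real (P - 1) * ln (real 4) \<le> ln (real P) + 10/3" by simp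
    hence "4 ^ (P - 1) \<le> 2 ^ 5 * P"
      using P5 ln2_ge_two_thirds by (intro ln_le_imp_power_le[of _ _ _ "10/3"]) auto
    thus False using \<open>32 * P < 4 ^ (P - 1)\<close> by simp
  qed
  thus ?thesis using Psi12.primitive_prime_of_numeric_bound[OF assms(1,2) big] by simp
qed

text \<open>
  Here the estimate \<open>\<phi> \<ge> P - 1\<close> with \<open>P = Max T\<close> only suffices for \<open>P \<ge> 7\<close>. For \<open>P = 3\<close> and \<open>P = 5\<close> the
  excluded values \<open>m = P\<close> are exactly those where \<open>\<phi>\<close> is as small as \<open>P - 1\<close>; for all other \<open>m\<close> it is at
  least \<open>6\<close> and \<open>8\<close>, respectively.
\<close>

lemma primitive_prime_4:
  fixes \<epsilon> :: int
  assumes "\<epsilon> \<in> {1, -1}" "odd m" "m > 1" "m \<notin> {3, 5}"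
  shows "\<exists>p. prime p \<and> p dvd psi4 (\<epsilon> * 2 ^ (m div 2)) \<and>
           (\<forall>i. 0 < i \<and> i < 4 * m \<longrightarrow> \<not> p dvd 2 ^ i - 1)"
proof (rule ccontr)
  assume "\<not> ?thesis"
  hence none: "\<And>p. prime p \<Longrightarrow> p dvd psi4 (\<epsilon> * int 2 ^ (m div 2)) \<Longrightarrow>
                 \<exists>i. 0 < i \<and> i < 4 * m \<and> p dvd int 2 ^ i - 1" by auto
  have big: "psi4 (\<epsilon> * int 2 ^ (m div 2)) > 1"
    using signed_power_times_succ_pos[of 2 m \<epsilon>] assms
    by (simp add: psi4_def power2_eq_square algebra_simps)
  define T where "T = Psi4.unramified_primes m"
  define \<phi> where "\<phi> = real m * (\<Prod>r\<in>T. 1 - 1 / real r)"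
  have m: "m > 0" using assms(3) by simp
  have T: "finite T" "T \<noteq> {}"
    using Psi4.finite_unramified[OF m] Psi4.no_primitive_prime_bound(1)[OF assms(1,2) big none] by (auto simp: T_def)
  have Tp: "prime r" "r dvd m" "\<not> r dvd 4" if "r \<in> T" for r
    using that by (auto simp: T_def Psi4.unramified_primes_def)
  have odd: "odd r" if "r \<in> T" for r using Tp(2)[OF that] assms(2) dvd_trans by blast
  have Tm: "\<Prod>T dvd m" using T(1) Tp(1,2) by (rule prod_primes_dvd)
  define P where "P = Max T"
  have P: "P \<in> T" using T by (simp add: P_def)
  have le: "r \<le> P" if "r \<in> T" for r using that T by (simp add: P_def)
  have bound: "\<phi> * ln 2 \<le> ln (real P) + 2"
    using Psi4.no_primitive_prime_bound(2)[OF assms(1,2) big none]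
    by (simp add: T_def[symmetric] P_def \<phi>_def mult_ac)
  have power_bound: "2 ^ N \<le> 8 * P" if "real N \<le> \<phi>" for N
  proof -
    have "real N * ln 2 \<le> \<phi> * ln 2" using that by (intro mult_right_mono) auto
    hence "real N * ln 2 \<le> ln (real P) + 2" using bound by linarith
    hence "2 ^ N \<le> 2 ^ 3 * P"
      by (intro ln_le_imp_power_le[where K = 2]) (use prime_gt_0_nat[OF Tp(1)[OF P]] ln2_ge_two_thirds in auto)
    thus ?thesis by simp
  qed
  have Pp: "prime P" "odd P" "P dvd m" using Tp[OF P] odd[OF P] by auto
  obtain k where k: "m = P * k" using Pp(3) by (rule dvdE)
  have small: "r \<ge> 3" if "r \<in> T" for r
    using prime_ge_2_nat[OF Tp(1)[OF that]] odd[OF that] by (cases "r = 2") auto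
  have "odd k" using k assms(2) by simp
  hence k3: "k \<ge> 3" if "k \<noteq> 1" using that by presburger
  have "P = 3 \<or> P = 5 \<or> P \<ge> 7" using small[OF P] Pp(2) by presburger
  then consider "P = 3" | "P = 5" | "P \<ge> 7" by blast
  thus False
  proof cases
    case 1
    have "r = 3" if "r \<in> T" for r using small[OF that] le[OF that] 1 by simp
    hence "T = {3}" using P 1 by blast
    hence "\<phi> = 2 * real k" using k 1 by (simp add: \<phi>_def)
    moreover have "k \<noteq> 1" using k 1 assms(4) by auto
    ultimately have "real 6 \<le> \<phi>" using k3 by simp
    thus False using power_bound[of 6] 1 by simp
  next
    case 2
    have "real 8 \<le> \<phi>"
    proof (cases "3 \<in> T")
      case True
      have "T \<subseteq> {3, 5}"
      proof
        fix r assume r: "r \<in> T"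
        hence "3 \<le> r" "r \<le> 5" "odd r" using small le odd 2 by auto
        thus "r \<in> {3, 5}" by (cases "r = 4") auto
      qed
      hence "T = {3, 5}" using True P 2 by auto
      hence "\<phi> = real m * (8/15)" "15 dvd m" using Tm by (auto simp: \<phi>_def)
      moreover from this m have "m \<ge> 15" by (auto dest: dvd_imp_le)
      ultimately show ?thesis by simp
    next
      case False
      have "T \<subseteq> {5}"
      proof
        fix r assume r: "r \<in> T"
        hence "3 \<le> r" "r \<le> 5" "odd r" "r \<noteq> 3" using small le odd 2 False by auto
        thus "r \<in> {5}" by (cases "r = 4") auto
      qed
      hence "T = {5}" using P 2 by auto
      hence "\<phi> = 4 * real k" using k 2 by (simp add: \<phi>_def)
      moreover have "k \<noteq> 1" using k 2 assms(4) by auto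
      ultimately show ?thesis using k3 by simp
    qed
    thus False using power_bound[of 8] 2 by simp
  next
    case 3
    have "real (P - 1) \<le> \<phi>"
      unfolding \<phi>_def using T Tp P m Tm by (intro prime_minus_one_le_prod) auto
    hence "2 ^ (P - 1) \<le> 8 * P" by (rule power_bound)
    moreover have "8 * P < 2 ^ (P - 1)" using 3 by (rule linear_less_power) auto
    ultimately show False by simp
  qed
qed

lemma sqrt_odd_power:
  assumes "odd m"
  shows "sqrt (real v ^ m) = real v ^ (m div 2) * sqrt (real v)"
proof -
  have "m = 2 * (m div 2) + 1" using assms by presburger
  hence "real v ^ m = (real v ^ (m div 2))\<^sup>2 * real v"
    by (metis power_add power_mult power_one_right mult.commute)
  thus ?thesis by (simp add: real_sqrt_mult)
qed

lemma poly_Psi_4: "poly (Psi 4) (of_int x * sqrt 2) = of_int (psi4 x)"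
proof -
  have "sqrt 2 * (sqrt 2 * a) = 2 * a" for a :: real
    by (metis mult.assoc real_sqrt_mult_self abs_numeral)
  thus ?thesis by (simp add: Psi_def psi4_def algebra_simps power2_eq_square)
qed

lemma poly_Psi_6: "poly (Psi 6) (of_int x * sqrt 3) = of_int (psi6 x)"
proof -
  have "sqrt 3 * (sqrt 3 * a) = 3 * a" for a :: real
    by (metis mult.assoc real_sqrt_mult_self abs_numeral)
  thus ?thesis by (simp add: Psi_def psi6_def algebra_simps power2_eq_square)
qed

lemma poly_Psi_12: "poly (Psi 12) (of_int x * sqrt 2) = of_int (psi12 x)"
proof -
  have "sqrt 2 * (sqrt 2 * a) = 2 * a" for a :: real
    by (metis mult.assoc real_sqrt_mult_self abs_numeral)
  thus ?thesis by (simp add: Psi_def psi12_def algebra_simps eval_nat_numeral)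
qed

theorem theorem2:
  fixes v n m :: nat and \<epsilon> :: real
  assumes "(v, n) \<in> {(2, 4), (3, 6), (2, 12)}"
    and "odd m" and "m > 1"
    and "\<epsilon> \<in> {1, -1}"
  shows "\<exists>N :: int. of_int N = poly (Psi n) (\<epsilon> * sqrt (real v ^ m)) \<and>
           ((\<exists>p :: int. prime p \<and> p dvd N \<and>
               (\<forall>i :: nat. 0 < i \<and> i < n * m \<longrightarrow> \<not> p dvd (int v ^ i - 1)))
            \<or> (v = 2 \<and> n = 4 \<and> m \<in> {3, 5}))"
proof -
  obtain s :: int where s: "s \<in> {1, -1}" "\<epsilon> = of_int s"
    using assms(4) by (metis insert_iff of_int_1 of_int_minus singletonD)
  define x where "x = s * int v ^ (m div 2)"
  have arg: "\<epsilon> * sqrt (real v ^ m) = of_int x * sqrt (real v)"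
    using s(2) by (simp add: sqrt_odd_power[OF assms(2)] x_def)
  consider "v = 2" "n = 4" | "v = 3" "n = 6" | "v = 2" "n = 12" using assms(1) by auto
  thus ?thesis
  proof cases
    case 1
    thus ?thesis using arg poly_Psi_4[of x] primitive_prime_4[OF s(1) assms(2,3)]
      by (intro exI[of _ "psi4 x"]) (auto simp: x_def)
  next
    case 2
    thus ?thesis using arg poly_Psi_6[of x] primitive_prime_6[OF s(1) assms(2,3)]
      by (intro exI[of _ "psi6 x"]) (auto simp: x_def)
  next
    case 3
    thus ?thesis using arg poly_Psi_12[of x] primitive_prime_12[OF s(1) assms(2,3)]
      by (intro exI[of _ "psi12 x"]) (auto simp: x_def)
  qed
qed

end
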